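(* For any integer $s\geq 3$, there exists an $s$-step nilpotent real Lie algebra which is irreducible, not nice and admits ad-invariant metrics.
   Context: Lie algebras are real and finite-dimensional. An ad-invariant metric on a Lie algebra is a nondegenerate symmetric bilinear form $g$ (any signature) with $g([X,Y],Z)=-g(Y,[X,Z])$ for all $X,Y,Z$. A Lie algebra is irreducible if it is not a direct sum of two nonzero ideals. A Lie algebra is nice if it has a nice basis, i.e. a basis $\{e_1,\dots,e_n\}$ with dual basis $\{e^1,\dots,e^n\}$ such that each $[e_i,e_j]$ is a (possibly zero) multiple of a basis element and each interior product $e_i\lrcorner\, de^j$ is a (possibly zero) multiple of an element of the dual basis, where $d$ is the Chevalley–Eilenberg differential, $de^k(X,Y)=-e^k([X,Y])$. *)

theory Defs
  imports "HOL-Analysis.Analysis" "HOL-Analysis.Finite_Function_Topology"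
begin

text \<open>
  A finite-dimensional real Lie algebra is a finite-dimensional linear subspace \<open>L\<close> of some ambient
  real vector space together with a bracket.  The bracket is a total function on the
  ambient type, but only its values on \<open>L\<close> are constrained or used; the same applies to bilinear
  and linear forms.  This makes the dimension a value, not a type, so that it may depend on other
  quantities inside a statement.
\<close>

definition linear_on_subspace :: "'a::real_vector set \<Rightarrow> ('a \<Rightarrow> 'b::real_vector) \<Rightarrow> bool"
  where "linear_on_subspace L f \<longleftrightarrow>
    (\<forall>x\<in>L. \<forall>y\<in>L. f (x + y) = f x + f y) \<and> (\<forall>c. \<forall>x\<in>L. f (c *\<^sub>R x) = c *\<^sub>R f x)"

definition bilinear_on_subspace ::
    "'a::real_vector set \<Rightarrow> ('a \<Rightarrow> 'a \<Rightarrow> 'b::real_vector) \<Rightarrow> bool"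
  where "bilinear_on_subspace L h \<longleftrightarrow>
    (\<forall>x\<in>L. linear_on_subspace L (\<lambda>y. h x y)) \<and> (\<forall>y\<in>L. linear_on_subspace L (\<lambda>x. h x y))"

locale lie_algebra =
  fixes L :: "'a::real_vector set" and br :: "'a \<Rightarrow> 'a \<Rightarrow> 'a"
  assumes subspace: "subspace L"
    and finite_dimensional: "\<exists>B. finite B \<and> span B = L"
    and bracket_closed: "x \<in> L \<Longrightarrow> y \<in> L \<Longrightarrow> br x y \<in> L"
    and bracket_bilinear: "bilinear_on_subspace L br"
    and bracket_alternating: "x \<in> L \<Longrightarrow> br x x = 0"
    and jacobi: "x \<in> L \<Longrightarrow> y \<in> L \<Longrightarrow> z \<in> L \<Longrightarrow>
      br x (br y z) + br y (br z x) + br z (br x y) = 0"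

primrec lower_central :: "'a::real_vector set \<Rightarrow> ('a \<Rightarrow> 'a \<Rightarrow> 'a) \<Rightarrow> nat \<Rightarrow> 'a set"
  where
    "lower_central L br 0 = L"
  | "lower_central L br (Suc k) = span {br x y | x y. x \<in> L \<and> y \<in> lower_central L br k}"

text \<open>With this indexing, nonzero abelian Lie algebras are exactly the 1-step nilpotent ones.\<close>

definition step_nilpotent :: "nat \<Rightarrow> 'a::real_vector set \<Rightarrow> ('a \<Rightarrow> 'a \<Rightarrow> 'a) \<Rightarrow> bool"
  where "step_nilpotent s L br \<longleftrightarrow>
    lower_central L br s = {0} \<and> (\<forall>k<s. lower_central L br k \<noteq> {0})"

definition lie_ideal :: "'a::real_vector set \<Rightarrow> 'a set \<Rightarrow> ('a \<Rightarrow> 'a \<Rightarrow> 'a) \<Rightarrow> bool"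
  where "lie_ideal I L br \<longleftrightarrow> subspace I \<and> I \<subseteq> L \<and> (\<forall>x\<in>L. \<forall>y\<in>I. br x y \<in> I)"

definition irreducible_lie :: "'a::real_vector set \<Rightarrow> ('a \<Rightarrow> 'a \<Rightarrow> 'a) \<Rightarrow> bool"
  where "irreducible_lie L br \<longleftrightarrow>
    \<not> (\<exists>I J. lie_ideal I L br \<and> lie_ideal J L br \<and> I \<noteq> {0} \<and> J \<noteq> {0} \<and>
          I \<inter> J = {0} \<and> L = {x + y | x y. x \<in> I \<and> y \<in> J})"

definition ad_invariant_metric ::
    "'a::real_vector set \<Rightarrow> ('a \<Rightarrow> 'a \<Rightarrow> 'a) \<Rightarrow> ('a \<Rightarrow> 'a \<Rightarrow> real) \<Rightarrow> bool"
  where "ad_invariant_metric L br g \<longleftrightarrow>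
    bilinear_on_subspace L g \<and>
    (\<forall>x\<in>L. \<forall>y\<in>L. g x y = g y x) \<and>
    (\<forall>x\<in>L. (\<forall>y\<in>L. g x y = 0) \<longrightarrow> x = 0) \<and>
    (\<forall>x\<in>L. \<forall>y\<in>L. \<forall>z\<in>L. g (br x y) z = - g y (br x z))"

text \<open>The element of the basis dual to \<open>B\<close> that corresponds to \<open>b \<in> B\<close>.\<close>

definition dual_basis_form :: "'a::real_vector set \<Rightarrow> 'a \<Rightarrow> 'a \<Rightarrow> real"
  where "dual_basis_form B b = (\<lambda>x. real_vector.representation B x b)"

text \<open>The Chevalley--Eilenberg differential of a 1-form.\<close>

definition ce_differential :: "('a \<Rightarrow> 'a \<Rightarrow> 'a) \<Rightarrow> ('a \<Rightarrow> real) \<Rightarrow> 'a \<Rightarrow> 'a \<Rightarrow> real"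
  where "ce_differential br \<alpha> = (\<lambda>x y. - \<alpha> (br x y))"

definition interior_product :: "'a \<Rightarrow> ('a \<Rightarrow> 'a \<Rightarrow> real) \<Rightarrow> 'a \<Rightarrow> real"
  where "interior_product v \<omega> = (\<lambda>y. \<omega> v y)"

text \<open>
  A basis is given as the set of its members; niceness does not depend on their order.  Equality of
  1-forms on \<open>L\<close> means equality of their values at all points of \<open>L\<close>.
\<close>

definition nice_basis :: "'a::real_vector set \<Rightarrow> 'a set \<Rightarrow> ('a \<Rightarrow> 'a \<Rightarrow> 'a) \<Rightarrow> bool"
  where "nice_basis B L br \<longleftrightarrow>
    finite B \<and> independent B \<and> span B = L \<and>
    (\<forall>u\<in>B. \<forall>v\<in>B. \<exists>w\<in>B. \<exists>c. br u v = c *\<^sub>R w) \<and>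
    (\<forall>u\<in>B. \<forall>v\<in>B. \<exists>w\<in>B. \<exists>c. \<forall>x\<in>L.
       interior_product u (ce_differential br (dual_basis_form B v)) x = c * dual_basis_form B w x)"

definition nice_lie :: "'a::real_vector set \<Rightarrow> ('a \<Rightarrow> 'a \<Rightarrow> 'a) \<Rightarrow> bool"
  where "nice_lie L br \<longleftrightarrow> (\<exists>B. nice_basis B L br)"

end

theory Submission
  imports Defs
begin

text \<open>
  The algebra has dimension \<open>2 * s + 14\<close> and a basis \<open>D\<close>, \<open>Z\<close>, \<open>A i\<close>, \<open>W i\<close> (\<open>i < s\<close>), \<open>X k\<close>, \<open>Y k\<close>
  (\<open>k < 6\<close>).  The metric pairs \<open>D\<close> with \<open>Z\<close>, \<open>A i\<close> with \<open>W i\<close> and \<open>X k\<close> with \<open>Y k\<close>.  The bracket is that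
  of the cotangent algebra of the model filiform algebra,
  \<open>[D, A i] = A (i + 1)\<close>, \<open>[D, W (i + 1)] = - W i\<close>, \<open>[A i, W (i + 1)] = Z\<close>,
  to which the 3-form \<open>\<phi> = D* \<and> \<rho> + (A 0)* \<and> \<omega>\<close> is added by means of the metric.  Here \<open>\<omega>\<close> is the
  standard symplectic form on the span of the \<open>X k\<close>, and \<open>\<rho>\<close> is the first of its three summands.
  The 3-form \<open>\<phi>\<close> vanishes when one argument lies in the derived algebra, and what it adds to a
  bracket lies in the centre, so it preserves the Jacobi identity; as it is alternating, it also
  preserves ad-invariance.  The filiform part makes the algebra \<open>s\<close>-step nilpotent.

  Irreducibility: if \<open>I\<close> and \<open>J\<close> are complementary ideals, then \<open>[I, J] = 0\<close>.  One of them, say \<open>I\<close>,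
  has an element with nonzero \<open>D\<close>-coordinate, and commuting with \<open>I\<close> forces \<open>J\<close> into the centre.
  But the centre is contained in the derived algebra, which is now \<open>[I, I]\<close> and hence lies in \<open>I\<close>;
  so \<open>J = {0}\<close>.

  Suppose that there is a nice basis \<open>B\<close>.  Call a subspace adapted if it is spanned by a subset of
  \<open>B\<close>.  Brackets and centralizers of adapted subspaces are adapted, and so are the terms of the lower
  central series.  Three consequences contradict each other.

  \<^item> Only one element of \<open>B\<close> has a nonzero \<open>D\<close>-coordinate (\<open>nice_basis_unique_D\<close>).  So the hyperplane
    where that coordinate vanishes is adapted, and its bracket with the last but one nonzero term of
    the lower central series is the line through \<open>Z\<close>.  Thus \<open>Z\<close> is a multiple of an element of \<open>B\<close>.

  \<^item> The centralizer of the derived algebra is adapted, and on it \<open>[u, v] = \<rho>(u, v) Z + \<omega>(u, v) W 0\<close>.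
    Hence there is another element \<open>f\<close> of \<open>B\<close> in the plane of \<open>Z\<close> and \<open>W 0\<close>, and in terms of \<open>Z\<close> and
    \<open>f\<close> the bracket has as its coefficients \<open>\<rho> - c \<omega>\<close> and a multiple of \<open>\<omega>\<close>, for some real \<open>c\<close>.

  \<^item> Niceness says that each of these two forms pairs every basis element with at most one
    other, and that no two basis elements are paired by both.  No basis of the six-dimensional space
    has this property, whatever \<open>c\<close> is (\<open>no_simultaneous_matching\<close>).

  The number \<open>c\<close> cannot be prescribed, as \<open>D\<close> may be replaced by \<open>D + t A 0\<close>, and \<open>\<rho>\<close> then by
  \<open>\<rho> + t \<omega>\<close>.  This is why the \<open>X k\<close> are six and not four: on a four-dimensional space the
  value \<open>c = 1/2\<close> puts the two summands of \<open>\<omega>\<close> on an equal footing, and then a basis that matches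
  both forms exists.
\<close>

section \<open>Nice bases and adapted subspaces\<close>

text \<open>
  A bilinear map on a subspace of an ambient type is unconstrained outside of it, so it is not
  bilinear on the type, and the inclusions in \<open>L\<close> have to be carried through the span inductions.
\<close>

lemma bilinear_on_subspace_span:
  assumes S: "S \<subseteq> L" and T: "T \<subseteq> L" and L: "subspace L"
    and h: "bilinear_on_subspace L h" and x: "x \<in> span S" and y: "y \<in> span T"
  shows "h x y \<in> span {h u v | u v. u \<in> S \<and> v \<in> T}" (is "_ \<in> ?R")
proof -
  have SL: "span S \<subseteq> L" and TL: "span T \<subseteq> L"
    using S T L by (simp_all add: span_minimal)
  have hl: "\<And>u. u \<in> L \<Longrightarrow> linear_on_subspace L (\<lambda>v. h u v)"
    and hr: "\<And>v. v \<in> L \<Longrightarrow> linear_on_subspace L (\<lambda>u. h u v)"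
    using h unfolding bilinear_on_subspace_def by blast+
  have zero: "h u 0 = 0" "h 0 u = 0" if "u \<in> L" for u
    using that hl[OF that] hr[OF that] L subspace_0[OF L] unfolding linear_on_subspace_def
    by (metis scaleR_zero_left)+
  have one: "y \<in> L \<and> h u y \<in> ?R" if u: "u \<in> S" for u
    using y
  proof (induction rule: span_induct_alt)
    case base
    show ?case using u S subspace_0[OF L] by (auto simp: zero span_zero subsetD)
  next
    case (step c v w)
    have v: "v \<in> L" "c *\<^sub>R v \<in> L" "u \<in> L" "w \<in> L"
      using step u S T L by (auto intro: subspace_scale)
    then have "h u (c *\<^sub>R v + w) = c *\<^sub>R h u v + h u w"
      using hl[of u] unfolding linear_on_subspace_def by metis
    moreover have "h u v \<in> ?R" using u step by (intro span_base) auto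
    ultimately show ?case using step v subspace_add[OF L] by (simp add: span_add span_scale)
  qed
  have yL: "y \<in> L" using y TL by auto
  have "x \<in> L \<and> h x y \<in> ?R" using x
  proof (induction rule: span_induct_alt)
    case base
    show ?case using yL subspace_0[OF L] by (auto simp: zero span_zero)
  next
    case (step c v w)
    have v: "v \<in> L" "c *\<^sub>R v \<in> L" "w \<in> L" using step S L by (auto intro: subspace_scale)
    then have "h (c *\<^sub>R v + w) y = c *\<^sub>R h v y + h w y"
      using hr[OF yL] unfolding linear_on_subspace_def by metis
    then show ?case using step one[of v] v subspace_add[OF L] by (simp add: span_add span_scale)
  qed
  then show ?thesis ..
qed

locale nice_lie_algebra = lie_algebra +
  fixes B
  assumes nice: "nice_basis B L br"
begin

abbreviation rep :: "'a \<Rightarrow> 'a \<Rightarrow> real"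
  where "rep \<equiv> real_vector.representation B"

lemma finite_B: "finite B" and indep_B: "independent B" and span_B: "span B = L"
  using nice unfolding nice_basis_def by auto

lemma B_in: "b \<in> B \<Longrightarrow> b \<in> L"
  using span_B span_superset by blast

lemma rep_add: "x \<in> L \<Longrightarrow> y \<in> L \<Longrightarrow> rep (x + y) b = rep x b + rep y b"
  and rep_scale: "x \<in> L \<Longrightarrow> rep (c *\<^sub>R x) b = c * rep x b"
  by (simp_all add: representation_add representation_scale indep_B span_B)

lemma rep_basis: "b \<in> B \<Longrightarrow> rep b b' = (if b' = b then 1 else 0)"
  by (simp add: representation_basis indep_B)

lemma rep_sum: "x \<in> L \<Longrightarrow> (\<Sum>b\<in>B. rep x b *\<^sub>R b) = x"
  using indep_B finite_B span_B by (intro real_vector.sum_representation_eq) auto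

lemma rep_linear_functional:
  assumes "linear f" "x \<in> L"
  shows "f x = (\<Sum>b\<in>B. rep x b *\<^sub>R f b)"
  using arg_cong[OF rep_sum[OF assms(2)], of f] assms(1)
  by (simp add: linear_sum linear_scale)

lemma bracket_linear:
  assumes "x \<in> L" "y \<in> L" "z \<in> L"
  shows "br x (y + z) = br x y + br x z" "br (y + z) x = br y x + br z x"
    "br x (c *\<^sub>R y) = c *\<^sub>R br x y" "br (c *\<^sub>R y) x = c *\<^sub>R br y x"
  using bracket_bilinear assms unfolding bilinear_on_subspace_def linear_on_subspace_def by blast+

lemma bracket_antisym:
  assumes "x \<in> L" "y \<in> L"
  shows "br x y = - br y x"
proof -
  have "br (x + y) (x + y) = br x x + br x y + (br y x + br y y)"
    using assms subspace_add[OF subspace] by (simp add: bracket_linear)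
  then show ?thesis
    using assms subspace_add[OF subspace assms]
    by (simp add: bracket_alternating eq_neg_iff_add_eq_0)
qed

lemma bracket_multiple:
  assumes "u \<in> B" "v \<in> B"
  obtains w c where "w \<in> B" "br u v = c *\<^sub>R w"
  using nice assms unfolding nice_basis_def by blast

lemma bracket_component_unique:
  assumes "u \<in> B" "v \<in> B" "rep (br u v) w \<noteq> 0" "rep (br u v) w' \<noteq> 0"
  shows "w = w'"
proof -
  obtain e c where "e \<in> B" "br u v = c *\<^sub>R e" using assms bracket_multiple by blast
  then show ?thesis using assms(3,4) by (auto simp: rep_scale B_in rep_basis split: if_splits)
qed

lemma interior_product_multiple:
  assumes "u \<in> B" "w \<in> B"
  obtains v c where "v \<in> B" "\<And>x. x \<in> L \<Longrightarrow> rep (br u x) w = c * rep x v"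
proof -
  obtain v c where v: "v \<in> B" and
    c: "\<And>x. x \<in> L \<Longrightarrow> interior_product u (ce_differential br (dual_basis_form B w)) x
      = c * dual_basis_form B v x"
    using nice assms unfolding nice_basis_def by blast
  have "rep (br u x) w = (- c) * rep x v" if "x \<in> L" for x
    using c[OF that] by (simp add: interior_product_def ce_differential_def dual_basis_form_def)
  then show ?thesis using v that by blast
qed

text \<open>
  The second condition on a nice basis, in the form in which it is used: the interior product of
  \<open>u\<close> with \<open>dw\<close> is a multiple of one dual basis element, which is the dual of both \<open>v\<close> and \<open>v'\<close>.
\<close>

lemma bracket_partner_unique:
  assumes "u \<in> B" "w \<in> B" "v \<in> B" "v' \<in> B" "rep (br u v) w \<noteq> 0" "rep (br u v') w \<noteq> 0"
  shows "v = v'"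
proof -
  obtain e c where e: "e \<in> B" "\<And>x. x \<in> L \<Longrightarrow> rep (br u x) w = c * rep x e"
    using interior_product_multiple assms by blast
  show ?thesis
    using e(2)[of v] e(2)[of v'] assms e(1) by (auto simp: B_in rep_basis split: if_splits)
qed

text \<open>
  Subspaces spanned by basis elements, described by coordinates: a basis element that occurs in a
  vector of \<open>V\<close> lies in \<open>V\<close>.
\<close>

definition adapted :: "'a set \<Rightarrow> bool"
  where "adapted V \<longleftrightarrow> subspace V \<and> V \<subseteq> L \<and> (\<forall>x\<in>V. \<forall>b\<in>B. rep x b \<noteq> 0 \<longrightarrow> b \<in> V)"

lemma adapted_span:
  assumes "adapted V"
  shows "V = span (V \<inter> B)"
proof
  show "V \<subseteq> span (V \<inter> B)"
  proof
    fix x assume x: "x \<in> V"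
    have "rep x b = 0 \<or> b \<in> V \<inter> B" if "b \<in> B" for b
      using x that assms unfolding adapted_def by auto
    then have "rep x b *\<^sub>R b \<in> span (V \<inter> B)" if "b \<in> B" for b
      using that by (metis scaleR_zero_left span_base span_scale span_zero)
    then have "(\<Sum>b\<in>B. rep x b *\<^sub>R b) \<in> span (V \<inter> B)" by (intro span_sum)
    then show "x \<in> span (V \<inter> B)" using rep_sum x assms unfolding adapted_def by auto
  qed
  show "span (V \<inter> B) \<subseteq> V" using assms unfolding adapted_def by (intro span_minimal) auto
qed

lemma adapted_functional:
  assumes "adapted V" "linear f" "x \<in> V" "f x \<noteq> (0::real)"
  obtains b where "b \<in> V" "b \<in> B" "f b \<noteq> 0"
proof -
  have "f y = 0" if "\<And>b. b \<in> V \<inter> B \<Longrightarrow> f b = 0" "y \<in> V" for y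
    using that adapted_span[OF assms(1)] assms(2) linear_eq_0_on_span by metis
  then show ?thesis using assms that by blast
qed

lemma adapted_whole: "adapted L"
  using subspace B_in unfolding adapted_def by auto

lemma adapted_span_multiples:
  assumes S: "\<And>x. x \<in> S \<Longrightarrow> \<exists>b\<in>B. \<exists>c. x = c *\<^sub>R b"
  shows "adapted (span S)"
proof -
  define T where "T = B \<inter> span S"
  have "x \<in> span T" if "x \<in> S" for x
  proof -
    obtain b c where b: "b \<in> B" "x = c *\<^sub>R b" using S \<open>x \<in> S\<close> by blast
    show ?thesis
    proof (cases "c = 0")
      case False
      then have "b = inverse c *\<^sub>R x" using b by simp
      then have "b \<in> span S" using \<open>x \<in> S\<close> by (simp add: span_base span_scale)
      then show ?thesis using b by (simp add: T_def span_base span_scale)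
    qed (use b in \<open>simp add: span_zero\<close>)
  qed
  then have "span S \<subseteq> span T" by (simp add: span_minimal subsetI)
  moreover have "span T \<subseteq> span S" by (simp add: T_def span_minimal)
  ultimately have eq: "span S = span T" by auto
  have TB: "T \<subseteq> B" by (simp add: T_def)
  have "b \<in> span T" if "x \<in> span T" "b \<in> B" "rep x b \<noteq> 0" for x b
  proof -
    have "rep x = real_vector.representation T x"
      using that TB by (intro representation_extend indep_B)
    then have "b \<in> T" using that representation_ne_zero by metis
    then show ?thesis by (simp add: span_base)
  qed
  moreover have "span T \<subseteq> L" using TB span_B span_mono by blast
  ultimately show ?thesis unfolding adapted_def eq by auto
qed

text \<open>
  By bilinearity the brackets of the basis elements in \<open>U\<close> and \<open>V\<close> suffice, and these are multiples
  of basis elements by the first condition on a nice basis.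
\<close>

lemma adapted_bracket:
  assumes U: "adapted U" and V: "adapted V"
  shows "adapted (span {br x y | x y. x \<in> U \<and> y \<in> V})" (is "adapted (span ?S)")
proof -
  let ?T = "{br x y | x y. x \<in> U \<inter> B \<and> y \<in> V \<inter> B}"
  have "br x y \<in> span ?T" if "x \<in> U" "y \<in> V" for x y
    using that adapted_span[OF U] adapted_span[OF V]
    by (intro bilinear_on_subspace_span[OF _ _ subspace bracket_bilinear]) (auto intro: B_in)
  then have "span ?S \<subseteq> span ?T" by (intro span_minimal) auto
  moreover have "span ?T \<subseteq> span ?S" by (intro span_mono) auto
  moreover have "adapted (span ?T)"
    by (intro adapted_span_multiples) (auto, metis bracket_multiple)
  ultimately show ?thesis by auto
qed

lemma adapted_lower_central: "adapted (lower_central L br k)"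
  by (induction k) (simp_all add: adapted_whole adapted_bracket)

definition centralizer :: "'a set \<Rightarrow> 'a set"
  where "centralizer V = {x \<in> L. \<forall>y\<in>V. br x y = 0}"

text \<open>
  This is where the second condition on a nice basis enters.  Let \<open>b\<close> occur in \<open>x\<close>, and let \<open>e\<close> be a
  basis element in \<open>V\<close> with \<open>[e, b]\<close> a nonzero multiple of \<open>w\<close>.  No other basis element contributes to
  the \<open>w\<close>-coordinate of \<open>[e, x]\<close>, which is therefore nonzero.
\<close>

lemma adapted_centralizer:
  assumes V: "adapted V"
  shows "adapted (centralizer V)"
proof -
  have VL: "V \<subseteq> L" using V unfolding adapted_def by auto
  have "br 0 y = 0" if "y \<in> L" for y
    using bracket_linear(4)[of y 0 y 0] that subspace_0[OF subspace] by simp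
  then have sub: "subspace (centralizer V)"
    using VL subspace_0[OF subspace] subspace_add[OF subspace] subspace_scale[OF subspace]
    unfolding centralizer_def by (intro subspaceI) (auto simp: bracket_linear subset_iff)
  have "b \<in> centralizer V" if x: "x \<in> centralizer V" and b: "b \<in> B" and nz: "rep x b \<noteq> 0" for x b
  proof -
    have xL: "x \<in> L" using x unfolding centralizer_def by auto
    have basis: "br b e = 0" if e: "e \<in> V" "e \<in> B" for e
    proof (rule ccontr)
      assume "br b e \<noteq> 0"
      moreover obtain w c where w: "w \<in> B" "br e b = c *\<^sub>R w"
        using bracket_multiple e b by blast
      ultimately have "c \<noteq> 0" using bracket_antisym[of b e] e b by (auto simp: B_in)
      obtain v d where v: "v \<in> B" and d: "\<And>y. y \<in> L \<Longrightarrow> rep (br e y) w = d * rep y v"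
        using interior_product_multiple e w by blast
      have "d * rep b v = c" using d[of b] w b by (simp add: B_in rep_scale rep_basis)
      then have "v = b" "d \<noteq> 0" using \<open>c \<noteq> 0\<close> b by (auto simp: rep_basis split: if_splits)
      moreover have "br e x = 0"
        using bracket_antisym[of e x] x xL e B_in unfolding centralizer_def by auto
      ultimately show False using d[OF xL] nz by (simp add: representation_zero)
    qed
    have "br b y = 0" if "y \<in> V" for y
    proof -
      have "br b y \<in> span {br u v | u v. u \<in> {b} \<and> v \<in> V \<inter> B}"
        using that adapted_span[OF V] b
        by (intro bilinear_on_subspace_span[OF _ _ subspace bracket_bilinear])
          (auto intro: B_in span_base)
      moreover have "span {br u v | u v. u \<in> {b} \<and> v \<in> V \<inter> B} \<subseteq> {0}"
        using basis by (intro span_minimal) (auto intro: subspace_single_0)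
      ultimately show ?thesis by blast
    qed
    then show ?thesis using b B_in unfolding centralizer_def by auto
  qed
  moreover have "centralizer V \<subseteq> L" unfolding centralizer_def by blast
  ultimately show ?thesis using sub unfolding adapted_def by blast
qed

end

section \<open>A pencil of 2-forms on a six-dimensional space\<close>

type_synonym vec6 = "real \<times> real \<times> real \<times> real \<times> real \<times> real"

fun rho6 :: "vec6 \<Rightarrow> vec6 \<Rightarrow> real"
  where "rho6 (x0, x1, x2, x3, x4, x5) (y0, y1, y2, y3, y4, y5) = x0 * y1 - x1 * y0"

fun omega6 :: "vec6 \<Rightarrow> vec6 \<Rightarrow> real"
  where "omega6 (x0, x1, x2, x3, x4, x5) (y0, y1, y2, y3, y4, y5) =
    x0 * y1 - x1 * y0 + x2 * y3 - x3 * y2 + x4 * y5 - x5 * y4"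

lemma linear_omega6: "linear (omega6 u)" and linear_rho6: "linear (rho6 u)"
  by (cases u; auto intro!: linearI simp: algebra_simps)+

lemma omega6_skew: "omega6 u v = - omega6 v u" and rho6_skew: "rho6 u v = - rho6 v u"
  by (cases u; cases v; simp)+

text \<open>
  The Pluecker relation for a decomposable form: if \<open>a\<close> and \<open>b\<close> are not proportional modulo the
  kernel of the form, then every vector outside the kernel pairs nontrivially with \<open>a\<close> or \<open>b\<close>.
\<close>

lemma rho6_pluecker: "rho6 a b * rho6 u v = rho6 u b * rho6 a v - rho6 u a * rho6 b v"
  by (cases u; cases v; cases a; cases b) (simp add: algebra_simps)

lemma omega6_nondegenerate:
  assumes "u \<noteq> 0"
  obtains v where "omega6 u v \<noteq> 0"
proof -
  obtain a b c d e f where u: "u = (a, b, c, d, e, f)" by (cases u)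
  have "omega6 u (- b, a, - d, c, - f, e) = a\<^sup>2 + b\<^sup>2 + c\<^sup>2 + d\<^sup>2 + e\<^sup>2 + f\<^sup>2"
    unfolding u by (simp add: power2_eq_square)
  moreover have "a\<^sup>2 + b\<^sup>2 + c\<^sup>2 + d\<^sup>2 + e\<^sup>2 + f\<^sup>2 \<noteq> 0"
    using assms unfolding u by (auto simp: zero_prod_def add_nonneg_eq_0_iff)
  ultimately show ?thesis using that by metis
qed

lemma span_functional:
  assumes "span E = UNIV" "linear f" "f x \<noteq> (0::real)"
  obtains e where "e \<in> E" "f e \<noteq> 0"
  using assms linear_eq_0_on_span[of f E x] by auto

text \<open>
  Let \<open>r u\<close> be the pair of coordinates of \<open>u\<close> on which \<open>\<rho>\<close> depends.

  If \<open>c\<close> is nonzero, then two vectors of \<open>E\<close> paired by \<open>\<omega>\<close> are also paired by \<open>\<rho>\<close>, because \<open>\<rho> - c \<omega>\<close>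
  vanishes on them.  Fix such a pair \<open>e1\<close>, \<open>e2\<close>.  Any other nonzero vector of \<open>E\<close> is paired by \<open>\<rho>\<close>,
  hence by \<open>\<rho> - c \<omega>\<close>, with \<open>e1\<close> or \<open>e2\<close>.  Each of these two has at most one such partner, so \<open>E\<close>
  has at most four nonzero vectors and cannot span six dimensions.

  If \<open>c = 0\<close>, take \<open>e1\<close> and \<open>e2\<close> paired by \<open>\<rho>\<close>.  Uniqueness of partners makes \<open>r\<close> vanish on the
  rest of \<open>E\<close>.  The \<open>\<omega>\<close>-partner \<open>e3\<close> of \<open>e1\<close> is then in the kernel of \<open>\<rho>\<close>, and it is
  \<open>\<omega>\<close>-orthogonal to that kernel, on which \<open>\<omega>\<close> is nondegenerate.
\<close>

lemma no_simultaneous_matching: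
  fixes E :: "vec6 set" and c :: real
  defines "alpha \<equiv> (\<lambda>u v. rho6 u v - c * omega6 u v)"
  assumes span: "span E = UNIV"
    and disjoint: "\<And>u v. u \<in> E \<Longrightarrow> v \<in> E \<Longrightarrow> omega6 u v = 0 \<or> alpha u v = 0"
    and omega: "\<And>u v w. u \<in> E \<Longrightarrow> v \<in> E \<Longrightarrow> w \<in> E \<Longrightarrow>
      omega6 u v \<noteq> 0 \<Longrightarrow> omega6 u w \<noteq> 0 \<Longrightarrow> v = w"
    and alpha: "\<And>u v w. u \<in> E \<Longrightarrow> v \<in> E \<Longrightarrow> w \<in> E \<Longrightarrow>
      alpha u v \<noteq> 0 \<Longrightarrow> alpha u w \<noteq> 0 \<Longrightarrow> v = w"
  shows False
proof -
  have partner: "\<exists>v\<in>E. omega6 u v \<noteq> 0" if "u \<noteq> 0" for u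
    using omega6_nondegenerate[OF that] span_functional[OF span linear_omega6] by metis
  have zero: "omega6 u 0 = 0" "rho6 u 0 = 0" for u
    by (simp_all add: linear_0 linear_omega6 linear_rho6)
  show False
  proof (cases "c = 0")
    case True
    have "rho6 (1,0,0,0,0,0) (0,1,0,0,0,0) \<noteq> 0" by simp
    then obtain e2 where e2: "e2 \<in> E" "rho6 (1,0,0,0,0,0) e2 \<noteq> 0"
      using span_functional[OF span linear_rho6] by metis
    then have "rho6 e2 (1,0,0,0,0,0) \<noteq> 0" using rho6_skew[of e2] by simp
    then obtain e1 where e1: "e1 \<in> E" "rho6 e2 e1 \<noteq> 0"
      using span_functional[OF span linear_rho6] by metis
    have r12: "rho6 e1 e2 \<noteq> 0" using e1 rho6_skew[of e1] by simp
    have r0: "rho6 u v = 0" if u: "u \<in> E" "u \<noteq> e1" "u \<noteq> e2" for u v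
    proof -
      have "rho6 u e1 = 0" "rho6 u e2 = 0"
        using alpha[of e1 e2 u] alpha[of e2 e1 u] u e1 e2 r12 rho6_skew[of u] True
        unfolding alpha_def by auto
      then show ?thesis using rho6_pluecker[of e1 e2 u v] r12 by simp
    qed
    have "e1 \<noteq> 0" using e1(2) zero by metis
    then obtain e3 where e3: "e3 \<in> E" "omega6 e1 e3 \<noteq> 0" using partner by blast
    have "omega6 e1 e2 = 0" using disjoint[of e1 e2] e1 e2 r12 True unfolding alpha_def by auto
    moreover have "omega6 e1 e1 = 0" using omega6_skew[of e1 e1] by simp
    ultimately have ne: "e3 \<noteq> e2" "e3 \<noteq> e1" using e3 by auto
    have w31: "omega6 e3 e1 \<noteq> 0" using e3 omega6_skew[of e3 e1] by simp
    \<comment> \<open>Both terms vanish on \<open>E\<close> except at \<open>e1\<close>, where they agree; so \<open>\<omega>(e3, _)\<close> is a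
        multiple of \<open>\<rho>(e2, _)\<close>.\<close>
    let ?f = "\<lambda>u. rho6 e2 e1 * omega6 e3 u - omega6 e3 e1 * rho6 e2 u"
    have "linear ?f"
      unfolding real_scaleR_def[symmetric]
      by (intro linear_compose_sub linear_compose_scale_right linear_omega6 linear_rho6)
    moreover have "?f u = 0" if u: "u \<in> E" for u
    proof (cases "u = e1")
      case False
      then have "omega6 e3 u = 0" using omega[of e3 e1 u] u e1 e3 w31 by auto
      moreover have "rho6 e2 u = 0"
        using r0[of u e2] u False rho6_skew[of e2 u] by (cases "u = e2") auto
      ultimately show ?thesis by simp
    qed simp
    ultimately have f: "?f u = 0" for u using linear_eq_0_on_span[of ?f E u] span by auto
    obtain a b x y z t where u: "e3 = (a, b, x, y, z, t)" by (cases e3)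
    obtain p q p1 p2 p3 p4 where v: "e2 = (p, q, p1, p2, p3, p4)" by (cases e2)
    have "a = 0" "b = 0"
      using r0[OF e3(1) ne(2,1), of "(0,1,0,0,0,0)"] r0[OF e3(1) ne(2,1), of "(1,0,0,0,0,0)"]
      unfolding u by auto
    moreover have "x = 0" "y = 0" "z = 0" "t = 0"
      using f[of "(0,0,0,1,0,0)"] f[of "(0,0,1,0,0,0)"] f[of "(0,0,0,0,0,1)"]
        f[of "(0,0,0,0,1,0)"] e1(2) unfolding u v by auto
    ultimately have "e3 = 0" unfolding u zero_prod_def by simp
    then show False using e3(2) zero by metis
  next
    case False
    have rho_partner: "rho6 u v \<noteq> 0" if "u \<in> E" "v \<in> E" "omega6 u v \<noteq> 0" for u v
      using disjoint[of u v] that False unfolding alpha_def by auto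
    have "omega6 (1,0,0,0,0,0) (0,1,0,0,0,0) \<noteq> 0" by simp
    then obtain e1 where e1: "e1 \<in> E" "omega6 (1,0,0,0,0,0) e1 \<noteq> 0"
      using span_functional[OF span linear_omega6] by metis
    then have "e1 \<noteq> 0" using zero by metis
    then obtain e2 where e2: "e2 \<in> E" "omega6 e1 e2 \<noteq> 0" using partner by blast
    have r12: "rho6 e1 e2 \<noteq> 0" using rho_partner e1 e2 by blast
    have w21: "omega6 e2 e1 \<noteq> 0" using e2 omega6_skew[of e2 e1] by simp
    define N where "N = (\<lambda>u. {v \<in> E. alpha u v \<noteq> 0})"
    have N: "finite (N u) \<and> card (N u) \<le> 1" if "u \<in> E" for u
    proof (cases "N u = {}")
      case False
      then obtain v where "v \<in> N u" by blast
      then have "N u = {v}" using alpha[OF that] unfolding N_def by blast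
      then show ?thesis by simp
    qed simp
    have sub: "E - {0} \<subseteq> {e1, e2} \<union> (N e1 \<union> N e2)"
    proof
      fix u assume u: "u \<in> E - {0}"
      then obtain v where v: "v \<in> E" "omega6 u v \<noteq> 0" using partner by blast
      then have "rho6 u v \<noteq> 0" using rho_partner u by blast
      then have "rho6 e1 u \<noteq> 0 \<or> rho6 e2 u \<noteq> 0"
        using rho6_pluecker[of e1 e2 u v] r12 rho6_skew[of u] by auto
      moreover have "omega6 e1 u = 0" if "u \<noteq> e2"
        using omega[of e1 e2 u] that u e1 e2 by auto
      moreover have "omega6 e2 u = 0" if "u \<noteq> e1"
        using omega[of e2 e1 u] that u e1 e2 w21 by auto
      ultimately show "u \<in> {e1, e2} \<union> (N e1 \<union> N e2)"
        using u unfolding N_def alpha_def by auto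
    qed
    have fin: "finite ({e1, e2} \<union> (N e1 \<union> N e2))" using N e1 e2 by simp
    have "dim (UNIV :: vec6 set) = dim (E - {0})"
      using span by (metis dim_span span_delete_0)
    also have "\<dots> \<le> card ({e1, e2} \<union> (N e1 \<union> N e2))"
      using dim_le_card[of "E - {0}" "{e1, e2} \<union> (N e1 \<union> N e2)"] sub fin span_superset by blast
    also have "\<dots> \<le> card {e1, e2} + (card (N e1) + card (N e2))"
      by (meson add_left_mono card_Un_le order_trans)
    also have "\<dots> \<le> 2 + (1 + 1)"
      using N[OF e1(1)] N[OF e2(1)] by (intro add_mono) (auto simp: card_insert_if)
    finally show False by simp
  qed
qed

section \<open>The metric Lie algebras\<close>

text \<open>
  The coordinates of \<open>D\<close>, \<open>Z\<close>, \<open>X k\<close>, \<open>Y k\<close>, \<open>A i\<close> and \<open>W i\<close>.  The \<open>A\<close>- and \<open>W\<close>-coordinates are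
  interleaved, so that their positions are independent of \<open>s\<close>, and they vanish for \<open>i \<ge> s\<close> on the
  space below.
\<close>

definition cD :: "(nat \<Rightarrow>\<^sub>0 real) \<Rightarrow> real" where "cD u = Poly_Mapping.lookup u 0"
definition cZ :: "(nat \<Rightarrow>\<^sub>0 real) \<Rightarrow> real" where "cZ u = Poly_Mapping.lookup u 1"
definition cX :: "(nat \<Rightarrow>\<^sub>0 real) \<Rightarrow> nat \<Rightarrow> real"
  where "cX u k = (if k < 6 then Poly_Mapping.lookup u (2 + k) else 0)"
definition cY :: "(nat \<Rightarrow>\<^sub>0 real) \<Rightarrow> nat \<Rightarrow> real"
  where "cY u k = (if k < 6 then Poly_Mapping.lookup u (8 + k) else 0)"
definition cA :: "(nat \<Rightarrow>\<^sub>0 real) \<Rightarrow> nat \<Rightarrow> real" where "cA u i = Poly_Mapping.lookup u (14 + 2 * i)"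
definition cW :: "(nat \<Rightarrow>\<^sub>0 real) \<Rightarrow> nat \<Rightarrow> real" where "cW u i = Poly_Mapping.lookup u (15 + 2 * i)"

lemmas coord_defs = cD_def cZ_def cX_def cY_def cA_def cW_def

definition g_space :: "nat \<Rightarrow> (nat \<Rightarrow>\<^sub>0 real) set"
  where "g_space s = {u. \<forall>k \<ge> 14 + 2 * s. Poly_Mapping.lookup u k = 0}"

definition of_coords :: "nat \<Rightarrow> real \<Rightarrow> real \<Rightarrow> (nat \<Rightarrow> real) \<Rightarrow> (nat \<Rightarrow> real)
    \<Rightarrow> (nat \<Rightarrow> real) \<Rightarrow> (nat \<Rightarrow> real) \<Rightarrow> (nat \<Rightarrow>\<^sub>0 real)"
  where "of_coords s d z x y a w = Abs_poly_mapping (\<lambda>k.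
    if k = 0 then d else if k = 1 then z else if k < 8 then x (k - 2) else if k < 14 then y (k - 8)
    else if 14 + 2 * s \<le> k then 0
    else if even k then a ((k - 14) div 2) else w ((k - 15) div 2))"

lemma lookup_of_coords: "Poly_Mapping.lookup (of_coords s d z x y a w) = (\<lambda>k.
    if k = 0 then d else if k = 1 then z else if k < 8 then x (k - 2) else if k < 14 then y (k - 8)
    else if 14 + 2 * s \<le> k then 0
    else if even k then a ((k - 14) div 2) else w ((k - 15) div 2))"
    (is "_ = ?f")
proof -
  have "k < 14 + 2 * s" if "?f k \<noteq> 0" for k
  proof (rule ccontr)
    assume "\<not> k < 14 + 2 * s"
    then have "?f k = 0" by simp
    then show False using that by blast
  qed
  then have "{k. ?f k \<noteq> 0} \<subseteq> {..<14 + 2 * s}" by blast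
  then have "finite {k. ?f k \<noteq> 0}" using finite_subset by blast
  then show ?thesis unfolding of_coords_def by (rule lookup_Abs_poly_mapping)
qed

lemma lookup_scaleR: "Poly_Mapping.lookup (c *\<^sub>R u) k = c * Poly_Mapping.lookup u k"
proof -
  have "{i. c *\<^sub>R Poly_Mapping.lookup u i \<noteq> 0} \<subseteq> Poly_Mapping.keys u"
    by (auto simp: in_keys_iff)
  then have "finite {i. c *\<^sub>R Poly_Mapping.lookup u i \<noteq> 0}" using finite_subset by fastforce
  then show ?thesis by (simp add: scaleR_poly_mapping_def lookup_Abs_poly_mapping)
qed

lemma coord_add [simp]: "cD (u + v) = cD u + cD v" "cZ (u + v) = cZ u + cZ v"
  "cX (u + v) k = cX u k + cX v k" "cY (u + v) k = cY u k + cY v k"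
  "cA (u + v) i = cA u i + cA v i" "cW (u + v) i = cW u i + cW v i"
  by (simp_all add: coord_defs lookup_add)

lemma coord_scale [simp]: "cD (c *\<^sub>R u) = c * cD u" "cZ (c *\<^sub>R u) = c * cZ u"
  "cX (c *\<^sub>R u) k = c * cX u k" "cY (c *\<^sub>R u) k = c * cY u k"
  "cA (c *\<^sub>R u) i = c * cA u i" "cW (c *\<^sub>R u) i = c * cW u i"
  by (simp_all add: coord_defs lookup_scaleR)

lemma coord_neg [simp]: "cD (- u) = - cD u" "cZ (- u) = - cZ u"
  "cX (- u) k = - cX u k" "cY (- u) k = - cY u k"
  "cA (- u) i = - cA u i" "cW (- u) i = - cW u i"
  by (simp_all add: coord_defs)

lemma coord_diff [simp]: "cD (u - v) = cD u - cD v" "cZ (u - v) = cZ u - cZ v"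
  "cX (u - v) k = cX u k - cX v k" "cY (u - v) k = cY u k - cY v k"
  "cA (u - v) i = cA u i - cA v i" "cW (u - v) i = cW u i - cW v i"
  by (simp_all add: coord_defs lookup_minus)

lemma coord_zero [simp]: "cD 0 = 0" "cZ 0 = 0" "cX 0 k = 0" "cY 0 k = 0" "cA 0 i = 0" "cW 0 i = 0"
  by (simp_all add: coord_defs)

lemma coord_of_coords [simp]: "cD (of_coords s d z x y a w) = d" "cZ (of_coords s d z x y a w) = z"
  "cX (of_coords s d z x y a w) k = (if k < 6 then x k else 0)"
  "cY (of_coords s d z x y a w) k = (if k < 6 then y k else 0)"
  "cA (of_coords s d z x y a w) i = (if i < s then a i else 0)"
  "cW (of_coords s d z x y a w) i = (if i < s then w i else 0)"
  by (simp_all add: coord_defs lookup_of_coords)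

lemma coord_linear: "linear cD" "linear cZ" "linear (\<lambda>u. cX u k)"
  "linear (\<lambda>u. cA u i)" "linear (\<lambda>u. cW u i)"
  by (simp_all add: linearI)

lemma of_coords_in [simp]: "of_coords s d z x y a w \<in> g_space s"
  by (simp add: g_space_def lookup_of_coords)

lemma subspace_g_space: "subspace (g_space s)"
  by (rule subspaceI) (simp_all add: g_space_def lookup_add lookup_scaleR)

lemma g_space_add [simp]: "u \<in> g_space s \<Longrightarrow> v \<in> g_space s \<Longrightarrow> u + v \<in> g_space s"
  and g_space_scale [simp]: "u \<in> g_space s \<Longrightarrow> c *\<^sub>R u \<in> g_space s"
  and g_space_neg [simp]: "u \<in> g_space s \<Longrightarrow> - u \<in> g_space s"
  and g_space_diff [simp]: "u \<in> g_space s \<Longrightarrow> v \<in> g_space s \<Longrightarrow> u - v \<in> g_space s"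
  and g_space_zero [simp]: "0 \<in> g_space s"
  by (simp_all add: subspace_g_space subspace_add subspace_scale subspace_neg subspace_diff subspace_0)

lemma g_space_out: "u \<in> g_space s \<Longrightarrow> s \<le> i \<Longrightarrow> cA u i = 0" "u \<in> g_space s \<Longrightarrow> s \<le> i \<Longrightarrow> cW u i = 0"
  by (simp_all add: g_space_def cA_def cW_def)

lemma g_space_eqI:
  assumes "u \<in> g_space s" "v \<in> g_space s" "cD u = cD v" "cZ u = cZ v"
    and X: "\<And>k. k < 6 \<Longrightarrow> cX u k = cX v k" and Y: "\<And>k. k < 6 \<Longrightarrow> cY u k = cY v k"
    and A: "\<And>i. i < s \<Longrightarrow> cA u i = cA v i" and W: "\<And>i. i < s \<Longrightarrow> cW u i = cW v i"
  shows "u = v"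
proof (rule poly_mapping_eqI)
  fix k
  consider "k = 0" | "k = 1" | "2 \<le> k" "k < 8" | "8 \<le> k" "k < 14" | "k \<ge> 14 + 2 * s"
    | "14 \<le> k" "k < 14 + 2 * s" by linarith
  then show "Poly_Mapping.lookup u k = Poly_Mapping.lookup v k"
  proof cases
    case 3
    then obtain j where "k = 2 + j" using le_Suc_ex by blast
    then show ?thesis using 3 X[of j] by (simp add: cX_def)
  next
    case 4
    then obtain j where "k = 8 + j" using le_Suc_ex by blast
    then show ?thesis using 4 Y[of j] by (simp add: cY_def)
  next
    case 6
    show ?thesis
    proof (cases "even k")
      case True
      then obtain j where "k = 2 * j" by blast
      moreover from this have "2 * j = 14 + 2 * (j - 7)" using 6 by linarith
      ultimately show ?thesis using 6 A[of "j - 7"] by (simp add: cA_def)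
    next
      case False
      then obtain j where "k = 2 * j + 1" using oddE by blast
      moreover from this have "2 * j + 1 = 15 + 2 * (j - 7)" using 6 by presburger
      ultimately show ?thesis using 6 W[of "j - 7"] by (simp add: cW_def)
    qed
  qed (use assms(1-4) in \<open>auto simp: cD_def cZ_def g_space_def\<close>)
qed

lemma g_space_finite_dimensional: "\<exists>B. finite B \<and> span B = g_space s"
proof (intro exI conjI)
  let ?B = "(\<lambda>k. Poly_Mapping.single k (1::real)) ` {..<14 + 2 * s}"
  show "finite ?B" by simp
  show "span ?B = g_space s"
  proof
    show "span ?B \<subseteq> g_space s"
      by (rule span_minimal[OF _ subspace_g_space]) (auto simp: g_space_def lookup_single when_def)
    show "g_space s \<subseteq> span ?B"
    proof
      fix u assume u: "u \<in> g_space s"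
      have "u = (\<Sum>k<14 + 2 * s. Poly_Mapping.lookup u k *\<^sub>R Poly_Mapping.single k 1)"
        using u by (intro poly_mapping_eqI)
          (auto simp: lookup_sum lookup_scaleR lookup_single when_def g_space_def if_distrib
            cong: if_cong)
      also have "\<dots> \<in> span ?B" by (intro span_sum span_scale span_base) auto
      finally show "u \<in> span ?B" .
    qed
  qed
qed

text \<open>
  The coordinates \<open>\<omega>(u, X k)\<close> of the linear form that \<open>\<omega>\<close> assigns to \<open>u\<close>.
\<close>

definition flat :: "(nat \<Rightarrow>\<^sub>0 real) \<Rightarrow> nat \<Rightarrow> real"
  where "flat u k = (if even k then - cX u (Suc k) else cX u (k - 1))"

definition omega :: "(nat \<Rightarrow>\<^sub>0 real) \<Rightarrow> (nat \<Rightarrow>\<^sub>0 real) \<Rightarrow> real"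
  where "omega u v = (\<Sum>k<6. flat u k * cX v k)"

definition rho :: "(nat \<Rightarrow>\<^sub>0 real) \<Rightarrow> (nat \<Rightarrow>\<^sub>0 real) \<Rightarrow> real"
  where "rho u v = (\<Sum>k<2. flat u k * cX v k)"

text \<open>
  The metric product of \<open>[D, u]\<close> with \<open>v\<close> when \<open>u\<close> is a combination of the \<open>A i\<close> and \<open>v\<close> of the \<open>W i\<close>.
\<close>

definition shift_form :: "nat \<Rightarrow> (nat \<Rightarrow>\<^sub>0 real) \<Rightarrow> (nat \<Rightarrow>\<^sub>0 real) \<Rightarrow> real"
  where "shift_form s u v = (\<Sum>i<s - 1. cA u i * cW v (Suc i))"

definition g_bracket :: "nat \<Rightarrow> (nat \<Rightarrow>\<^sub>0 real) \<Rightarrow> (nat \<Rightarrow>\<^sub>0 real) \<Rightarrow> (nat \<Rightarrow>\<^sub>0 real)"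
  where "g_bracket s u v = of_coords s 0
    (shift_form s u v - shift_form s v u + rho u v)
    (\<lambda>_. 0)
    (\<lambda>k. (if k < 2 then cD u * flat v k - cD v * flat u k else 0)
        + cA u 0 * flat v k - cA v 0 * flat u k)
    (\<lambda>i. if i = 0 then 0 else cD u * cA v (i - 1) - cD v * cA u (i - 1))
    (\<lambda>i. cD v * cW u (Suc i) - cD u * cW v (Suc i) + (if i = 0 then omega u v else 0))"

definition g_metric :: "nat \<Rightarrow> (nat \<Rightarrow>\<^sub>0 real) \<Rightarrow> (nat \<Rightarrow>\<^sub>0 real) \<Rightarrow> real"
  where "g_metric s u v = cD u * cZ v + cZ u * cD v + (\<Sum>i<s. cA u i * cW v i + cW u i * cA v i)
    + (\<Sum>k<6. cX u k * cY v k + cY u k * cX v k)"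

lemma flat_linear [simp]: "flat (u + v) k = flat u k + flat v k" "flat (c *\<^sub>R u) k = c * flat u k"
  "flat 0 k = 0"
  by (simp_all add: flat_def)

lemma flat_eq_0: "(\<And>k. cX u k = 0) \<Longrightarrow> flat u k = 0"
  by (simp add: flat_def)

lemma flat_nondegenerate:
  assumes "\<And>l. l < 6 \<Longrightarrow> flat u l = 0"
  shows "cX u k = 0"
proof (cases "k < 6")
  case True
  show ?thesis
  proof (cases "even k")
    case even: True
    have "k \<noteq> 5" using even by (auto dest: arg_cong[of _ _ even])
    then have "Suc k < 6" using True by linarith
    then show ?thesis using assms[of "Suc k"] even by (simp add: flat_def)
  next
    case False
    then have "even (k - 1)" "Suc (k - 1) = k" by (auto elim: oddE)
    then show ?thesis using assms[of "k - 1"] True by (simp add: flat_def)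
  qed
qed (simp add: cX_def)

lemma sum_lessThan_6: "(\<Sum>k<6. f k) = f 0 + f 1 + f 2 + f 3 + f 4 + f (5::nat)"
  for f :: "nat \<Rightarrow> real"
  by (simp add: eval_nat_numeral)

lemma omega_expand: "omega u v = cX u 0 * cX v 1 - cX u 1 * cX v 0 + cX u 2 * cX v 3
    - cX u 3 * cX v 2 + cX u 4 * cX v 5 - cX u 5 * cX v 4"
  by (simp add: omega_def flat_def sum_lessThan_6)

lemma rho_expand: "rho u v = cX u 0 * cX v 1 - cX u 1 * cX v 0"
  by (simp add: rho_def flat_def numeral_2_eq_2)

lemma forms_add [simp]: "omega (u + v) w = omega u w + omega v w"
    "omega w (u + v) = omega w u + omega w v"
    "rho (u + v) w = rho u w + rho v w" "rho w (u + v) = rho w u + rho w v"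
    "shift_form s (u + v) w = shift_form s u w + shift_form s v w"
    "shift_form s w (u + v) = shift_form s w u + shift_form s w v"
  by (simp_all add: omega_expand rho_expand shift_form_def algebra_simps sum.distrib)

lemma forms_scale [simp]: "omega (c *\<^sub>R u) w = c * omega u w"
    "omega w (c *\<^sub>R u) = c * omega w u"
    "rho (c *\<^sub>R u) w = c * rho u w" "rho w (c *\<^sub>R u) = c * rho w u"
    "shift_form s (c *\<^sub>R u) w = c * shift_form s u w"
    "shift_form s w (c *\<^sub>R u) = c * shift_form s w u"
  by (simp_all add: omega_expand rho_expand shift_form_def algebra_simps sum_distrib_left)

lemma forms_skew: "omega u v = - omega v u" "rho u v = - rho v u"
  by (simp_all add: omega_expand rho_expand)

lemma g_bracket_in [simp]: "g_bracket s u v \<in> g_space s"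
  by (simp add: g_bracket_def)

lemma coord_bracket:
  "cD (g_bracket s u v) = 0"
  "cZ (g_bracket s u v) = shift_form s u v - shift_form s v u + rho u v"
  "cX (g_bracket s u v) k = 0"
  "cY (g_bracket s u v) k = (if k < 6 then (if k < 2 then cD u * flat v k - cD v * flat u k else 0)
        + cA u 0 * flat v k - cA v 0 * flat u k else 0)"
  "cA (g_bracket s u v) i = (if 0 < i \<and> i < s then cD u * cA v (i - 1) - cD v * cA u (i - 1) else 0)"
  "cW (g_bracket s u v) i = (if i < s then cD v * cW u (Suc i) - cD u * cW v (Suc i)
      + (if i = 0 then omega u v else 0) else 0)"
  by (simp_all add: g_bracket_def)

lemma g_bracket_bilinear: "bilinear_on_subspace (g_space s) (g_bracket s)"
  unfolding bilinear_on_subspace_def linear_on_subspace_def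
  by (intro conjI ballI allI g_space_eqI[of _ s]; simp add: coord_bracket algebra_simps)

lemma flat_bracket [simp]: "flat (g_bracket s u v) k = 0"
  by (simp add: flat_def coord_bracket)

text \<open>
  By the difference of the two values, the \<open>Z\<close>-coordinate of \<open>[u, [v, w]]\<close> involves \<open>S\<close> only through the
  symmetric combinations \<open>S u v + S v u\<close> and \<open>S u w + S w u\<close>; so it cancels in the Jacobi sum.
\<close>

lemma shift_form_bracket:
  assumes "s \<ge> 3" "u \<in> g_space s" "v \<in> g_space s" "w \<in> g_space s"
  defines "S \<equiv> \<lambda>u v. \<Sum>i<s - 2. cA u i * cW v (i + 2)"
  shows "shift_form s u (g_bracket s v w) = cD w * S u v - cD v * S u w"
    "shift_form s (g_bracket s v w) u = cD v * S w u - cD w * S v u"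
proof -
  define n where "n = s - 3"
  have s: "s = Suc (Suc (Suc n))" using assms(1) unfolding n_def by simp
  have "cW v (Suc (Suc (Suc n))) = 0" "cW w (Suc (Suc (Suc n))) = 0"
    using g_space_out(2)[of v s s] g_space_out(2)[of w s s] assms s by auto
  then show "shift_form s u (g_bracket s v w) = cD w * S u v - cD v * S u w"
    unfolding S_def shift_form_def s
    by (simp add: coord_bracket sum_distrib_left sum_subtractf algebra_simps cong: sum.cong_simp)
  have "shift_form s (g_bracket s v w) u = (\<Sum>i<Suc n. cA (g_bracket s v w) (Suc i) * cW u (i + 2))"
    unfolding shift_form_def s diff_Suc_1 by (subst sum.lessThan_Suc_shift) (simp add: coord_bracket)
  also have "\<dots> = cD v * S w u - cD w * S v u"
    unfolding S_def s
    by (simp add: coord_bracket sum_distrib_left sum_subtractf algebra_simps cong: sum.cong_simp)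
  finally show "shift_form s (g_bracket s v w) u = cD v * S w u - cD w * S v u" .
qed

lemma g_space_lie_algebra:
  assumes s: "s \<ge> 3"
  shows "lie_algebra (g_space s) (g_bracket s)"
proof
  show "subspace (g_space s)" by (rule subspace_g_space)
  show "\<exists>B. finite B \<and> span B = g_space s" by (rule g_space_finite_dimensional)
  show "g_bracket s x y \<in> g_space s" for x y by simp
  show "bilinear_on_subspace (g_space s) (g_bracket s)" by (rule g_bracket_bilinear)
  show "g_bracket s x x = 0" if "x \<in> g_space s" for x
    using that forms_skew[of x x] by (intro g_space_eqI[of _ s]) (simp_all add: coord_bracket)
  show "g_bracket s x (g_bracket s y z) + g_bracket s y (g_bracket s z x) +
      g_bracket s z (g_bracket s x y) = 0"
    if "x \<in> g_space s" "y \<in> g_space s" "z \<in> g_space s" for x y z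
    using that s by (intro g_space_eqI[of _ s])
      (auto simp: coord_bracket shift_form_bracket omega_expand rho_expand algebra_simps)
qed

text \<open>
  The right-hand side is visibly alternating in \<open>u\<close>, \<open>v\<close>, \<open>w\<close>, and for the bracket of a
  Lie algebra this is ad-invariance.  Its \<open>\<rho>\<close>- and \<open>\<omega>\<close>-terms are the 3-form \<open>D* \<and> \<rho> + (A 0)* \<and> \<omega>\<close>.
\<close>

lemma g_metric_bracket:
  assumes s: "s \<ge> 3" and u: "u \<in> g_space s" "v \<in> g_space s" "w \<in> g_space s"
  shows "g_metric s (g_bracket s u v) w =
    cD w * (shift_form s u v - shift_form s v u + rho u v) +
    cD u * (shift_form s v w - shift_form s w v + rho v w) +
    cD v * (shift_form s w u - shift_form s u w + rho w u) +
    cA w 0 * omega u v + cA u 0 * omega v w + cA v 0 * omega w u"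
proof -
  obtain n where n: "s = Suc n" using s by (cases s) auto
  have out: "cW u (Suc n) = 0" "cW v (Suc n) = 0"
    using g_space_out(2) u n by auto
  have Y: "(\<Sum>k<6. cY (g_bracket s u v) k * cX w k) =
      cD u * rho v w + cD v * rho w u + cA u 0 * omega v w + cA v 0 * omega w u"
    by (simp add: coord_bracket omega_expand rho_expand flat_def sum_lessThan_6 algebra_simps)
  have A: "(\<Sum>i<s. cA (g_bracket s u v) i * cW w i) = cD u * shift_form s v w - cD v * shift_form s u w"
    unfolding n sum.lessThan_Suc_shift
    by (simp add: coord_bracket shift_form_def sum_distrib_left sum_subtractf[symmetric] algebra_simps
        cong: sum.cong_simp)
  have "(\<Sum>i<s. cW (g_bracket s u v) i * cA w i) =
      (\<Sum>i<s. (cD v * cW u (Suc i) - cD u * cW v (Suc i)) * cA w i) + omega u v * cA w 0"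
    unfolding n sum.lessThan_Suc_shift by (simp add: coord_bracket algebra_simps)
  also have "\<dots> = cD v * shift_form s w u - cD u * shift_form s w v + omega u v * cA w 0"
    unfolding n using out
    by (simp add: shift_form_def sum_distrib_left sum_subtractf[symmetric] algebra_simps
        cong: sum.cong_simp)
  finally have W: "(\<Sum>i<s. cW (g_bracket s u v) i * cA w i) = \<dots>" .
  show ?thesis
    unfolding g_metric_def sum.distrib A W
    using Y by (simp add: coord_bracket algebra_simps)
qed

lemma g_metric_sym: "g_metric s u v = g_metric s v u"
  unfolding g_metric_def by (simp add: algebra_simps)

lemma g_metric_ad_invariant:
  assumes s: "s \<ge> 3"
  shows "ad_invariant_metric (g_space s) (g_bracket s) (g_metric s)"
  unfolding ad_invariant_metric_def
proof (intro conjI ballI impI)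
  show "bilinear_on_subspace (g_space s) (g_metric s)"
    unfolding bilinear_on_subspace_def linear_on_subspace_def g_metric_def
    by (simp add: algebra_simps sum.distrib sum_distrib_left)
  show "g_metric s x y = g_metric s y x" for x y by (rule g_metric_sym)
  show "g_metric s (g_bracket s x y) z = - g_metric s y (g_bracket s x z)"
    if "x \<in> g_space s" "y \<in> g_space s" "z \<in> g_space s" for x y z
    unfolding g_metric_sym[of s y] using that s forms_skew[of x] forms_skew[of y z]
    by (simp add: g_metric_bracket algebra_simps)
  show "x = 0" if x: "x \<in> g_space s" and 0: "\<forall>y\<in>g_space s. g_metric s x y = 0" for x
  proof -
    have m: "g_metric s x (of_coords s d z a b e f) = 0" for d z a b e f using 0 by simp
    show ?thesis
    proof (rule g_space_eqI[of _ s])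
      fix k :: nat assume "k < 6"
      then show "cX x k = cX 0 k" "cY x k = cY 0 k"
        using m[of 0 0 "\<lambda>_. 0" "\<lambda>j. if j = k then 1 else 0" "\<lambda>_. 0" "\<lambda>_. 0"]
          m[of 0 0 "\<lambda>j. if j = k then 1 else 0" "\<lambda>_. 0" "\<lambda>_. 0" "\<lambda>_. 0"]
        by (simp_all add: g_metric_def mult_delta_right cong: sum.cong_simp)
    next
      fix i assume "i < s"
      then show "cA x i = cA 0 i" "cW x i = cW 0 i"
        using m[of 0 0 "\<lambda>_. 0" "\<lambda>_. 0" "\<lambda>_. 0" "\<lambda>j. if j = i then 1 else 0"]
          m[of 0 0 "\<lambda>_. 0" "\<lambda>_. 0" "\<lambda>j. if j = i then 1 else 0" "\<lambda>_. 0"]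
        by (simp_all add: g_metric_def mult_delta_right cong: sum.cong_simp)
    qed (use x m[of 0 1 "\<lambda>_. 0" "\<lambda>_. 0" "\<lambda>_. 0" "\<lambda>_. 0"] m[of 1 0 "\<lambda>_. 0" "\<lambda>_. 0" "\<lambda>_. 0" "\<lambda>_. 0"]
        in \<open>simp_all add: g_metric_def\<close>)
  qed
qed

section \<open>Nilpotency step and irreducibility\<close>

text \<open>
  An upper bound for the terms of the lower central series of index at least 1.  The line through
  \<open>Z\<close> survives up to index \<open>s - 1\<close>, which is why its coordinate is restricted from \<open>k = s\<close> on only.
\<close>

definition filtration :: "nat \<Rightarrow> nat \<Rightarrow> (nat \<Rightarrow>\<^sub>0 real) set"
  where "filtration s k = {u \<in> g_space s. cD u = 0 \<and> (\<forall>j. cX u j = 0) \<and> (\<forall>i<k. cA u i = 0) \<and>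
    (\<forall>i. s \<le> i + k \<longrightarrow> cW u i = 0) \<and> (s \<le> k \<longrightarrow> cZ u = 0 \<and> (\<forall>j. cY u j = 0))}"

lemma subspace_filtration: "subspace (filtration s k)"
  by (rule subspaceI) (auto simp: filtration_def)

lemma shift_form_eq_0:
  assumes "\<And>i. i < s - 1 \<Longrightarrow> cA u i = 0 \<or> cW v (Suc i) = 0"
  shows "shift_form s u v = 0"
  unfolding shift_form_def using assms by (intro sum.neutral) auto

lemma forms_eq_0: "(\<And>k. cX u k = 0) \<Longrightarrow> omega u v = 0" "(\<And>k. cX u k = 0) \<Longrightarrow> rho u v = 0"
  "(\<And>k. cX v k = 0) \<Longrightarrow> omega u v = 0" "(\<And>k. cX v k = 0) \<Longrightarrow> rho u v = 0"
  by (simp_all add: omega_expand rho_expand)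

lemma bracket_filtration:
  assumes s: "s \<ge> 3" and u: "u \<in> g_space s" and v: "v \<in> filtration s k" and k: "k \<ge> 1"
  shows "g_bracket s u v \<in> filtration s (Suc k)"
proof -
  have v': "v \<in> g_space s" "cD v = 0" "\<And>j. cX v j = 0" "\<And>i. i < k \<Longrightarrow> cA v i = 0"
    "\<And>i. s \<le> i + k \<Longrightarrow> cW v i = 0"
    using v unfolding filtration_def by auto
  have X: "flat v j = 0" for j using v'(3) by (rule flat_eq_0)
  have Z: "cZ (g_bracket s u v) = 0" if "s \<le> Suc k"
  proof -
    have "shift_form s u v = 0" "shift_form s v u = 0"
      using that v' by (auto intro!: shift_form_eq_0)
    then show ?thesis using v'(3) by (simp add: coord_bracket forms_eq_0)
  qed
  have Y: "cY (g_bracket s u v) j = 0" for j using k v'(2,4) X by (simp add: coord_bracket)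
  have A: "cA (g_bracket s u v) i = 0" if "i < Suc k" for i
    using that v'(2) v'(4)[of "i - 1"] by (cases i) (auto simp: coord_bracket)
  have W: "cW (g_bracket s u v) i = 0" if "s \<le> i + Suc k" for i
    using that v'(2,3) v'(5)[of "Suc i"] by (simp add: coord_bracket forms_eq_0)
  show ?thesis using Z Y A W unfolding filtration_def by (simp add: coord_bracket)
qed

lemma lower_central_filtration:
  assumes s: "s \<ge> 3"
  shows "lower_central (g_space s) (g_bracket s) (Suc k) \<subseteq> filtration s (Suc k)"
proof (induction k)
  case 0
  have "g_bracket s u v \<in> filtration s 1" if "u \<in> g_space s" "v \<in> g_space s" for u v
    using that s g_space_out(2) unfolding filtration_def by (auto simp: coord_bracket)
  moreover have "lower_central (g_space s) (g_bracket s) (Suc 0) =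
      span {g_bracket s x y | x y. x \<in> g_space s \<and> y \<in> g_space s}"
    by simp
  ultimately show ?case by (simp only:) (intro span_minimal subspace_filtration; auto)
next
  case (Suc k)
  have "g_bracket s u v \<in> filtration s (Suc (Suc k))"
    if "u \<in> g_space s" "v \<in> lower_central (g_space s) (g_bracket s) (Suc k)" for u v
    using that Suc bracket_filtration[OF s, of u v "Suc k"] by auto
  then show ?case unfolding lower_central.simps(2)[of _ _ "Suc k"]
    by (intro span_minimal subspace_filtration) auto
qed

definition eD :: "nat \<Rightarrow> nat \<Rightarrow>\<^sub>0 real"
  where "eD s = of_coords s 1 0 (\<lambda>_. 0) (\<lambda>_. 0) (\<lambda>_. 0) (\<lambda>_. 0)"
definition eZ :: "nat \<Rightarrow> nat \<Rightarrow>\<^sub>0 real"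
  where "eZ s = of_coords s 0 1 (\<lambda>_. 0) (\<lambda>_. 0) (\<lambda>_. 0) (\<lambda>_. 0)"
definition eX :: "nat \<Rightarrow> (nat \<Rightarrow> real) \<Rightarrow> nat \<Rightarrow>\<^sub>0 real"
  where "eX s x = of_coords s 0 0 x (\<lambda>_. 0) (\<lambda>_. 0) (\<lambda>_. 0)"
definition eA :: "nat \<Rightarrow> nat \<Rightarrow> nat \<Rightarrow>\<^sub>0 real"
  where "eA s i = of_coords s 0 0 (\<lambda>_. 0) (\<lambda>_. 0) (\<lambda>j. if j = i then 1 else 0) (\<lambda>_. 0)"
definition eW :: "nat \<Rightarrow> nat \<Rightarrow> nat \<Rightarrow>\<^sub>0 real"
  where "eW s i = of_coords s 0 0 (\<lambda>_. 0) (\<lambda>_. 0) (\<lambda>_. 0) (\<lambda>j. if j = i then 1 else 0)"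

lemmas e_defs = eD_def eZ_def eX_def eA_def eW_def

lemma e_in [simp]: "eD s \<in> g_space s" "eZ s \<in> g_space s" "eX s x \<in> g_space s"
  "eA s i \<in> g_space s" "eW s i \<in> g_space s"
  by (simp_all add: e_defs)

lemma coord_e [simp]:
  "cD (eD s) = 1" "cZ (eD s) = 0" "cX (eD s) k = 0" "cY (eD s) k = 0"
  "cA (eD s) j = 0" "cW (eD s) j = 0"
  "cD (eZ s) = 0" "cZ (eZ s) = 1" "cX (eZ s) k = 0" "cY (eZ s) k = 0"
  "cA (eZ s) j = 0" "cW (eZ s) j = 0"
  "cD (eX s x) = 0" "cZ (eX s x) = 0" "cX (eX s x) k = (if k < 6 then x k else 0)" "cY (eX s x) k = 0"
  "cA (eX s x) j = 0" "cW (eX s x) j = 0"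
  "cD (eA s i) = 0" "cZ (eA s i) = 0" "cX (eA s i) k = 0" "cY (eA s i) k = 0"
  "cA (eA s i) j = (if j = i \<and> j < s then 1 else 0)" "cW (eA s i) j = 0"
  "cD (eW s i) = 0" "cZ (eW s i) = 0" "cX (eW s i) k = 0" "cY (eW s i) k = 0" "cA (eW s i) j = 0"
  "cW (eW s i) j = (if j = i \<and> j < s then 1 else 0)"
  by (simp_all add: e_defs)

lemma bracket_eD_eA: "Suc i < s \<Longrightarrow> g_bracket s (eD s) (eA s i) = eA s (Suc i)"
  by (rule g_space_eqI[of _ s])
    (auto simp: coord_bracket shift_form_eq_0 forms_eq_0 flat_def)

lemma bracket_eD_eW: "Suc i < s \<Longrightarrow> g_bracket s (eD s) (eW s (Suc i)) = - eW s i"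
  by (rule g_space_eqI[of _ s])
    (auto simp: coord_bracket shift_form_eq_0 forms_eq_0 flat_def)

lemma bracket_in_lower_central:
  "u \<in> L \<Longrightarrow> v \<in> lower_central L b k \<Longrightarrow> b u v \<in> lower_central L b (Suc k)"
  by (auto intro!: span_base)

lemma eA_lower_central: "k < s \<Longrightarrow> eA s k \<in> lower_central (g_space s) (g_bracket s) k"
proof (induction k)
  case (Suc k)
  then show ?case using bracket_in_lower_central[of "eD s" "g_space s" "eA s k" "g_bracket s" k]
      bracket_eD_eA[of k s]
    by (simp del: lower_central.simps(2))
qed simp

lemma eW_lower_central: "k < s \<Longrightarrow> eW s (s - 1 - k) \<in> lower_central (g_space s) (g_bracket s) k"
proof (induction k)
  case (Suc k)
  have "g_bracket s (eD s) (eW s (s - 1 - k)) = - eW s (s - 1 - Suc k)"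
    using bracket_eD_eW[of "s - 1 - Suc k" s] Suc.prems by (simp add: Suc_diff_Suc)
  then have "- eW s (s - 1 - Suc k) \<in> lower_central (g_space s) (g_bracket s) (Suc k)"
    using Suc bracket_in_lower_central[of "eD s" "g_space s" "eW s (s - 1 - k)" "g_bracket s" k]
    by (simp del: lower_central.simps(2))
  then show ?case unfolding lower_central.simps using span_neg by fastforce
qed simp

lemma g_space_step_nilpotent:
  assumes s: "s \<ge> 3"
  shows "step_nilpotent s (g_space s) (g_bracket s)"
  unfolding step_nilpotent_def
proof (intro conjI allI impI)
  obtain m where m: "s = Suc m" using s by (cases s) auto
  have "filtration s s \<subseteq> {0}"
    using g_space_out by (auto simp: filtration_def intro!: g_space_eqI[of _ s])
  moreover have "0 \<in> lower_central (g_space s) (g_bracket s) (Suc m)" by (simp add: span_zero)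
  ultimately show "lower_central (g_space s) (g_bracket s) s = {0}"
    using lower_central_filtration[OF s, of m] unfolding m by blast
  fix k assume k: "k < s"
  have "cA (eA s k) k = 1" using k by simp
  then have "eA s k \<noteq> 0" using coord_zero(5)[of k] by (metis zero_neq_one)
  then show "lower_central (g_space s) (g_bracket s) k \<noteq> {0}" using eA_lower_central[OF k] by blast
qed

text \<open>
  The assumptions describe the span of \<open>A (s - 1)\<close>, \<open>W 0\<close>, \<open>Z\<close> and the \<open>Y k\<close>.
\<close>

lemma bracket_central:
  assumes "cD j = 0" "\<And>k. cX j k = 0" "\<And>i. Suc i < s \<Longrightarrow> cA j i = 0"
    "\<And>i. Suc i < s \<Longrightarrow> cW j (Suc i) = 0" "j \<in> g_space s" "s \<ge> 3"
  shows "g_bracket s j y = 0"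
proof -
  have "shift_form s j y = 0" "shift_form s y j = 0"
    using assms by (auto intro!: shift_form_eq_0)
  moreover have "cW j (Suc i) = 0" for i
    using assms g_space_out(2)[of j s "Suc i"] by (cases "Suc i < s") auto
  moreover have "cA j (i - 1) = 0" if "i < s" "0 < i" for i
    using assms(3)[of "i - 1"] that by simp
  moreover have "cA j 0 = 0" using assms by simp
  ultimately show ?thesis using assms(1,2)
    by (intro g_space_eqI[of _ s]) (auto simp: coord_bracket forms_eq_0 flat_eq_0)
qed

text \<open>
  Elements of \<open>I\<close> commute with those of \<open>J\<close>.  Therefore \<open>D\<close>-coordinates vanish on \<open>J\<close>: otherwise
  the \<open>A 0\<close>-coordinate would be a fixed multiple of the \<open>D\<close>-coordinate on \<open>I\<close> and on \<open>J\<close>, hence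
  everywhere.  Commuting with \<open>u\<close> and with the \<open>I\<close>-component of \<open>A 0\<close> then makes \<open>J\<close> central.  So \<open>I\<close>
  contains all brackets, and every element of \<open>J\<close> is a sum of two brackets.
\<close>

lemma direct_summand_trivial:
  assumes s: "s \<ge> 3" and I: "lie_ideal I (g_space s) (g_bracket s)"
    and J: "lie_ideal J (g_space s) (g_bracket s)"
    and IJ: "I \<inter> J = {0}" and sum: "g_space s = {x + y | x y. x \<in> I \<and> y \<in> J}"
    and u: "u \<in> I" "cD u \<noteq> 0"
  shows "J = {0}"
proof -
  interpret lie_algebra "g_space s" "g_bracket s" by (rule g_space_lie_algebra[OF s])
  have sub: "I \<subseteq> g_space s" "J \<subseteq> g_space s" "subspace I" "subspace J"
    using I J unfolding lie_ideal_def by auto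
  have skew: "g_bracket s x y = - g_bracket s y x" if "x \<in> g_space s" "y \<in> g_space s" for x y
    using that forms_skew[of x y] by (intro g_space_eqI[of _ s])
      (auto simp: coord_bracket)
  have inI: "g_bracket s x y \<in> I" if "x \<in> I" "y \<in> g_space s" for x y
    using that I skew[of x y] sub subspace_neg[of I] unfolding lie_ideal_def by auto
  have comm: "g_bracket s i j = 0" if "i \<in> I" "j \<in> J" for i j
  proof -
    have "g_bracket s i j \<in> I" using inI[of i j] that sub by blast
    moreover have "g_bracket s i j \<in> J" using J that sub unfolding lie_ideal_def by blast
    ultimately show ?thesis using IJ by blast
  qed
  have decomp: "\<exists>i\<in>I. \<exists>j\<in>J. x = i + j" if "x \<in> g_space s" for x
    using that sum by blast
  have A1: "cD i * cA j 0 = cD j * cA i 0" if "i \<in> I" "j \<in> J" for i j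
    using arg_cong[OF comm[OF that], of "\<lambda>x. cA x 1"] s by (simp add: coord_bracket)
  have D: "cD j = 0" if j: "j \<in> J" for j
  proof (rule ccontr)
    assume nz: "cD j \<noteq> 0"
    have iI: "cA i 0 * cD j = cD i * cA j 0" if "i \<in> I" for i
      using A1[OF that j] by (simp add: mult.commute)
    have jJ: "cA j' 0 * cD j = cD j' * cA j 0" if "j' \<in> J" for j'
    proof -
      have "cD u * (cA j' 0 * cD j) = cD u * (cD j' * cA j 0)"
        using A1[OF u(1) that] iI[OF u(1)] by (simp add: algebra_simps)
      then show ?thesis using u by simp
    qed
    obtain i j' where "i \<in> I" "j' \<in> J" "eA s 0 = i + j'" using decomp[of "eA s 0"] by auto
    then have "cA (eA s 0) 0 * cD j = cD (eA s 0) * cA j 0"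
      using iI jJ by (simp add: algebra_simps)
    then show False using nz s by simp
  qed
  have A0: "cA j 0 = 0" if "j \<in> J" for j
    using A1[OF u(1) that] D[OF that] u by simp
  obtain i0 j0 where i0: "i0 \<in> I" "j0 \<in> J" "eA s 0 = i0 + j0" using decomp[of "eA s 0"] by auto
  have "cD (eA s 0) = 0" "cA (eA s 0) 0 = 1" using s by auto
  then have i0': "cD i0 = 0" "cA i0 0 = 1" using i0 D[of j0] A0[of j0] by auto
  have X: "cX j k = 0" if j: "j \<in> J" for j k
  proof (rule flat_nondegenerate)
    fix l :: nat assume "l < 6"
    then show "flat j l = 0"
      using arg_cong[OF comm[OF i0(1) j], of "\<lambda>x. cY x l"] i0' D[OF j] A0[OF j]
      by (simp add: coord_bracket split: if_splits)
  qed
  have A: "cA j i = 0" if "j \<in> J" "Suc i < s" for j i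
    using arg_cong[OF comm[OF u(1) that(1)], of "\<lambda>x. cA x (Suc i)"] that u D[OF that(1)]
    by (simp add: coord_bracket)
  have W: "cW j (Suc i) = 0" if "j \<in> J" "Suc i < s" for j i
    using arg_cong[OF comm[OF u(1) that(1)], of "\<lambda>x. cW x i"] that u D[OF that(1)] X[OF that(1)]
    by (simp add: coord_bracket forms_eq_0 split: if_splits)
  have central: "g_bracket s j y = 0" if "j \<in> J" for j y
    using that D X A W sub s by (intro bracket_central) auto
  have derived: "g_bracket s x y \<in> I" if "x \<in> g_space s" "y \<in> g_space s" for x y
  proof -
    obtain i j where ij: "i \<in> I" "j \<in> J" "x = i + j" using decomp[OF \<open>x \<in> g_space s\<close>] by blast
    then have "g_bracket s x y = g_bracket s i y + g_bracket s j y"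
      using bracket_bilinear sub \<open>y \<in> g_space s\<close>
      unfolding bilinear_on_subspace_def linear_on_subspace_def by blast
    then show ?thesis using ij that by (simp add: central inI)
  qed
  have "j \<in> I" if j: "j \<in> J" for j
  proof -
    \<comment> \<open>\<open>[D, p]\<close> supplies the \<open>A (s - 1)\<close>- and \<open>W 0\<close>-coordinates of \<open>j\<close>, and \<open>[A 0, q]\<close> the
        \<open>Z\<close>- and \<open>Y\<close>-coordinates.\<close>
    define p where "p = of_coords s 0 0 (\<lambda>_. 0) (\<lambda>_. 0)
      (\<lambda>i. if Suc i < s then cA j (Suc i) else 0) (\<lambda>i. if i = 1 then - cW j 0 else 0)"
    define q where "q = of_coords s 0 0 (\<lambda>k. if even k then cY j (Suc k) else - cY j (k - 1)) (\<lambda>_. 0)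
      (\<lambda>_. 0) (\<lambda>i. if i = 1 then cZ j else 0)"
    have p: "cD p = 0" "cX p k = 0" "cA p i = (if Suc i < s then cA j (Suc i) else 0)"
      "cW p i = (if i = 1 \<and> i < s then - cW j 0 else 0)" "p \<in> g_space s" for i k
      by (auto simp: p_def)
    have q: "cD q = 0" "cA q i = 0" "cW q i = (if i = 1 \<and> i < s then cZ j else 0)" "q \<in> g_space s" for i
      by (auto simp: q_def)
    have flat: "flat q k = cY j k" "flat p k = 0" "flat (eD s) k = 0" "flat (eA s 0) k = 0"
      if "k < 6" for k
      using that by (auto simp: flat_def p q_def)
    have "shift_form s (eD s) p = 0" "shift_form s p (eD s) = 0" "shift_form s q (eA s 0) = 0"
      by (rule shift_form_eq_0, simp add: p q)+
    moreover have "shift_form s (eA s 0) q = (\<Sum>i<s - 1. if i = 0 then cZ j else 0)"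
      unfolding shift_form_def by (rule sum.cong) (auto simp: q)
    moreover have "cW j i = 0" if "0 < i" "i < s" for i using W[OF j, of "i - 1"] that by simp
    moreover have "rho (eD s) p = 0" "rho (eA s 0) q = 0" "omega (eD s) p = 0" "omega (eA s 0) q = 0"
      by (simp_all add: forms_eq_0)
    ultimately have "j = g_bracket s (eD s) p + g_bracket s (eA s 0) q"
      using j sub(2) D[OF j] X[OF j] A[OF j] s
      by (intro g_space_eqI[of _ s]) (auto simp: coord_bracket flat p q)
    moreover have "g_bracket s (eD s) p + g_bracket s (eA s 0) q \<in> I"
      using derived[of "eD s" p] derived[of "eA s 0" q] subspace_add[OF sub(3)]
      by (simp add: p q)
    ultimately show ?thesis by simp
  qed
  then show ?thesis using IJ subspace_0[OF sub(4)] by blast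
qed

lemma g_space_irreducible:
  assumes s: "s \<ge> 3"
  shows "irreducible_lie (g_space s) (g_bracket s)"
  unfolding irreducible_lie_def
proof
  assume "\<exists>I J. lie_ideal I (g_space s) (g_bracket s) \<and> lie_ideal J (g_space s) (g_bracket s) \<and>
      I \<noteq> {0} \<and> J \<noteq> {0} \<and>
      I \<inter> J = {0} \<and> g_space s = {x + y | x y. x \<in> I \<and> y \<in> J}"
  then obtain I J where I: "lie_ideal I (g_space s) (g_bracket s)" "I \<noteq> {0}"
    and J: "lie_ideal J (g_space s) (g_bracket s)" "J \<noteq> {0}"
    and IJ: "I \<inter> J = {0}" and sum: "g_space s = {x + y | x y. x \<in> I \<and> y \<in> J}" by blast
  have sum': "g_space s = {x + y | x y. x \<in> J \<and> y \<in> I}"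
    unfolding sum using add.commute by blast
  obtain x y where xy: "x \<in> I" "y \<in> J" "eD s = x + y" using e_in(1)[of s] unfolding sum by blast
  have "cD (eD s) = 1" by simp
  then have "cD x \<noteq> 0 \<or> cD y \<noteq> 0" using xy by auto
  then show False
    using direct_summand_trivial[OF s I(1) J(1) IJ sum xy(1)]
      direct_summand_trivial[OF s J(1) I(1) _ sum' xy(2)] I J IJ by blast
qed

section \<open>Nonexistence of nice bases\<close>

text \<open>
  A bracket with the last but one nonzero term of the lower central series lies in the span of
  \<open>A (s - 1)\<close>, \<open>W 0\<close> and \<open>Z\<close>.  Modulo \<open>Z\<close>, it depends on \<open>b\<close> only through the factor \<open>cD b\<close>.
\<close>

lemma bracket_filtration_top:
  assumes s: "s \<ge> 3" and b: "b \<in> g_space s" and f: "f \<in> filtration s (s - 2)"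
  shows "g_bracket s b f = of_coords s 0 (cA b 0 * cW f 1 - cA f (s - 2) * cW b (s - 1)) (\<lambda>_. 0) (\<lambda>_. 0)
    (\<lambda>i. if i = s - 1 then cD b * cA f (s - 2) else 0)
    (\<lambda>i. if i = 0 then - cD b * cW f 1 else 0)"
proof -
  have f': "f \<in> g_space s" "cD f = 0" "\<And>j. cX f j = 0" "\<And>i. i < s - 2 \<Longrightarrow> cA f i = 0"
    "\<And>i. 1 < i \<Longrightarrow> cW f i = 0"
    using f s unfolding filtration_def by auto
  have "shift_form s b f = (\<Sum>i<s - 1. if i = 0 then cA b 0 * cW f 1 else 0)"
    unfolding shift_form_def using f'(5) by (intro sum.cong) auto
  then have 1: "shift_form s b f = cA b 0 * cW f 1" using s by simp
  have "shift_form s f b = (\<Sum>i<s - 1. if i = s - 2 then cA f (s - 2) * cW b (s - 1) else 0)"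
    unfolding shift_form_def
  proof (rule sum.cong)
    fix i assume i: "i \<in> {..<s - 1}"
    show "cA f i * cW b (Suc i) = (if i = s - 2 then cA f (s - 2) * cW b (s - 1) else 0)"
    proof (cases "i = s - 2")
      case True
      then have "Suc i = s - 1" using s by linarith
      then show ?thesis using True by simp
    next
      case False
      then have "i < s - 2" using i by auto
      then show ?thesis using f'(4) by simp
    qed
  qed simp
  then have 2: "shift_form s f b = cA f (s - 2) * cW b (s - 1)" using s by simp
  have 3: "cA f (i - 1) = (if i = s - 1 then cA f (s - 2) else 0)" if "0 < i" "i < s" for i
  proof (cases "i = s - 1")
    case True
    then have "i - 1 = s - 2" by simp
    then show ?thesis using True by simp
  qed (use that f'(4)[of "i - 1"] in auto)
  have 4: "cW f (Suc i) = 0" if "0 < i" for i using that f'(5)[of "Suc i"] by simp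
  have "cA f 0 = 0" using f'(4)[of 0] s by simp
  moreover have "cA f (s - Suc (Suc 0)) = cA f (s - 2)" by (simp add: numeral_2_eq_2)
  ultimately show ?thesis
    using 1 2 f'(2,3) s 3
    by (intro g_space_eqI[of _ s]) (auto simp: coord_bracket forms_eq_0 flat_eq_0 4)
qed

lemma eZ_eq_bracket: "s \<ge> 3 \<Longrightarrow> eZ s = g_bracket s (eA s 0) (eW s 1)"
proof -
  assume s: "s \<ge> 3"
  have "shift_form s (eA s 0) (eW s 1) = (\<Sum>i<s - 1. if i = 0 then 1 else 0)"
    unfolding shift_form_def by (intro sum.cong) auto
  moreover have "shift_form s (eW s 1) (eA s 0) = 0" by (rule shift_form_eq_0) simp
  ultimately show ?thesis using s
    by (intro g_space_eqI[of _ s]) (auto simp: coord_bracket forms_eq_0 flat_def)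
qed

lemma forms_linear: "linear (omega u)"
  by (simp add: linearI)

lemma centralizer_derived:
  assumes s: "s \<ge> 3" and u: "u \<in> g_space s"
    and c: "\<And>y. y \<in> lower_central (g_space s) (g_bracket s) 1 \<Longrightarrow> g_bracket s u y = 0"
  shows "cD u = 0" "cW u (s - 1) = 0" "i + 2 < s \<Longrightarrow> cA u i = 0"
proof -
  have A: "eA s i \<in> lower_central (g_space s) (g_bracket s) 1" if "1 \<le> i" "i < s" for i
    using that bracket_eD_eA[of "i - 1" s]
      bracket_in_lower_central[of "eD s" "g_space s" "eA s (i - 1)" "g_bracket s" 0]
    by simp
  have W: "eW s i \<in> lower_central (g_space s) (g_bracket s) 1" if "Suc i < s" for i
    using that bracket_eD_eW[of i s]
      bracket_in_lower_central[of "eD s" "g_space s" "eW s (Suc i)" "g_bracket s" 0]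
      span_neg[of "- eW s i"]
    by simp
  have "g_bracket s u (eA s 1) = 0" using c A s by simp
  from arg_cong[OF this, of "\<lambda>x. cA x 2"] show "cD u = 0"
    using s by (simp add: coord_bracket)
  have "shift_form s (eA s (s - 2)) u = (\<Sum>i<s - 1. if i = s - 2 then cW u (Suc (s - 2)) else 0)"
    unfolding shift_form_def using s by (intro sum.cong) auto
  moreover have "Suc (s - 2) = s - 1" using s by simp
  ultimately have 1: "shift_form s (eA s (s - 2)) u = cW u (s - 1)" using s by simp
  have "shift_form s u (eA s (s - 2)) = 0" by (rule shift_form_eq_0) simp
  moreover have "cZ (g_bracket s u (eA s (s - 2))) = 0" using c A s by simp
  ultimately show "cW u (s - 1) = 0" using 1 by (simp add: coord_bracket forms_eq_0)
  assume i: "i + 2 < s"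
  have "shift_form s u (eW s (Suc i)) = (\<Sum>j<s - 1. if j = i then cA u i else 0)"
    unfolding shift_form_def using i by (intro sum.cong) auto
  then have 1: "shift_form s u (eW s (Suc i)) = cA u i" using i by simp
  have "shift_form s (eW s (Suc i)) u = 0" by (rule shift_form_eq_0) simp
  moreover have "cZ (g_bracket s u (eW s (Suc i))) = 0" using c W i by simp
  ultimately show "cA u i = 0" using 1 by (simp add: coord_bracket forms_eq_0)
qed

text \<open>
  The centralizer of the derived algebra contains all \<open>X k\<close>, and the filiform part of the bracket
  vanishes on it.  What remains of the bracket is the pencil spanned by \<open>\<rho>\<close> and \<open>\<omega>\<close>.
\<close>

lemma bracket_centralizer:
  assumes s: "s \<ge> 3"
    and u: "u \<in> g_space s" "cD u = 0" "cW u (s - 1) = 0" "\<And>i. i + 2 < s \<Longrightarrow> cA u i = 0"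
    and v: "v \<in> g_space s" "cD v = 0" "cW v (s - 1) = 0" "\<And>i. i + 2 < s \<Longrightarrow> cA v i = 0"
  shows "g_bracket s u v = rho u v *\<^sub>R eZ s + omega u v *\<^sub>R eW s 0"
proof -
  have "cA u i * cW v (Suc i) = 0" "cA v i * cW u (Suc i) = 0" if "i < s - 1" for i
  proof -
    have "i + 2 < s \<or> Suc i = s - 1" using that by linarith
    then show "cA u i * cW v (Suc i) = 0" "cA v i * cW u (Suc i) = 0"
      using u(3,4) v(3,4) by auto
  qed
  then have "shift_form s u v = 0" "shift_form s v u = 0"
    unfolding shift_form_def by (auto intro!: sum.neutral)
  moreover have "cA u 0 = 0" "cA v 0 = 0" using s u(4) v(4) by auto
  ultimately show ?thesis
    using u v s by (intro g_space_eqI[of _ s]) (auto simp: coord_bracket)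
qed

lemma lower_central_in_filtration:
  "s \<ge> 3 \<Longrightarrow> 1 \<le> k \<Longrightarrow> lower_central (g_space s) (g_bracket s) k \<subseteq> filtration s k"
  using lower_central_filtration[of s "k - 1"] by (simp del: lower_central.simps)

lemma eX_centralizes:
  assumes s: "s \<ge> 3" and y: "y \<in> lower_central (g_space s) (g_bracket s) 1"
  shows "g_bracket s (eX s x) y = 0"
proof -
  have y': "y \<in> g_space s" "cD y = 0" "\<And>j. cX y j = 0" "cA y 0 = 0"
    using lower_central_in_filtration[of s 1] s y unfolding filtration_def by auto
  have "shift_form s (eX s x) y = 0" "shift_form s y (eX s x) = 0"
    by (auto intro!: shift_form_eq_0)
  then show ?thesis using y'
    by (intro g_space_eqI[of _ s]) (auto simp: coord_bracket forms_eq_0 flat_eq_0)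
qed

definition xvec :: "(nat \<Rightarrow>\<^sub>0 real) \<Rightarrow> vec6"
  where "xvec u = (cX u 0, cX u 1, cX u 2, cX u 3, cX u 4, cX u 5)"

lemma linear_xvec: "linear xvec"
  by (simp add: xvec_def linearI)

lemma forms_xvec: "omega u v = omega6 (xvec u) (xvec v)" "rho u v = rho6 (xvec u) (xvec v)"
  by (simp_all add: xvec_def omega_expand rho_expand)

lemma xvec_surj: "\<exists>x. xvec (eX s x) = p"
proof -
  obtain p0 p1 p2 p3 p4 p5 where p: "p = (p0, p1, p2, p3, p4, p5)" by (cases p)
  let ?x = "\<lambda>k. [p0, p1, p2, p3, p4, p5] ! k"
  have "xvec (eX s ?x) = p" unfolding p by (simp add: xvec_def)
  then show ?thesis by blast
qed

text \<open>
  Let \<open>f\<close> be a noncentral basis element in the last but one nonzero term of the lower central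
  series.  Modulo \<open>Z\<close>, the brackets \<open>[b, f]\<close> and \<open>[b', f]\<close> are proportional; but if \<open>b\<close> and \<open>b'\<close>
  differ, they are multiples of distinct basis elements \<open>w\<close> and \<open>w'\<close>.  Hence \<open>Z\<close> is a combination
  of \<open>w\<close> and \<open>w'\<close> with nonzero coefficients, and so it determines the set \<open>{w, w'}\<close>.  But there
  are two such \<open>f\<close> that are independent modulo the centre, and no bracket of one of
  them with \<open>b\<close> or \<open>b'\<close> is proportional to a bracket of the other with \<open>b\<close> or \<open>b'\<close>.
\<close>

lemma nice_basis_unique_D:
  fixes s :: nat
  assumes s: "s \<ge> 3" and nice: "nice_basis B (g_space s) (g_bracket s)"
    and b: "b \<in> B" "b' \<in> B" "cD b \<noteq> 0" "cD b' \<noteq> 0"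
  shows "b = b'"
proof (rule ccontr)
  assume ne: "b \<noteq> b'"
  interpret lie_algebra "g_space s" "g_bracket s" by (rule g_space_lie_algebra[OF s])
  interpret nice_lie_algebra "g_space s" "g_bracket s" B by unfold_locales (rule nice)
  let ?G = "lower_central (g_space s) (g_bracket s) (s - 2)"
  have G: "?G \<subseteq> filtration s (s - 2)" using lower_central_in_filtration s by simp
  have adG: "adapted ?G" by (rule adapted_lower_central)
  have key: "\<exists>w w' k k'. k \<noteq> 0 \<and> k' \<noteq> 0 \<and> g_bracket s b f = k *\<^sub>R w \<and> g_bracket s b' f = k' *\<^sub>R w' \<and>
      {e. rep (eZ s) e \<noteq> 0} = {w, w'}"
    if f: "f \<in> ?G" "f \<in> B" "cA f (s - 2) \<noteq> 0 \<or> cW f 1 \<noteq> 0" for f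
  proof -
    have fil: "f \<in> filtration s (s - 2)" using f G by blast
    have bracket_top: "g_bracket s c f = of_coords s 0
        (cA c 0 * cW f 1 - cA f (s - 2) * cW c (s - 1)) (\<lambda>_. 0) (\<lambda>_. 0)
        (\<lambda>i. if i = s - 1 then cD c * cA f (s - 2) else 0)
        (\<lambda>i. if i = 0 then - cD c * cW f 1 else 0)" if "c \<in> B" for c
      using bracket_filtration_top[OF s B_in[OF that] fil] .
    have nz: "g_bracket s c f \<noteq> 0" if "c \<in> B" "cD c \<noteq> 0" for c
    proof
      assume "g_bracket s c f = 0"
      then have "cA (g_bracket s c f) (s - 1) = 0" "cW (g_bracket s c f) 0 = 0" by simp_all
      then show False using f(3) that s by (auto simp: bracket_top)
    qed
    obtain w k where w: "w \<in> B" "g_bracket s b f = k *\<^sub>R w" using bracket_multiple b f by blast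
    obtain w' k' where w': "w' \<in> B" "g_bracket s b' f = k' *\<^sub>R w'" using bracket_multiple b f by blast
    have k: "k \<noteq> 0" "k' \<noteq> 0" using nz[of b] nz[of b'] b w w' by auto
    have "w \<noteq> w'"
    proof
      assume eq: "w = w'"
      have "rep (g_bracket s f b) w = - k" "rep (g_bracket s f b') w = - k'"
        using bracket_antisym[of f b] bracket_antisym[of f b'] w w' f b eq
          rep_scale[of w "- k" w] rep_scale[of w "- k'" w]
        by (simp_all add: B_in rep_basis)
      then show False
        using bracket_partner_unique[of f w b b'] f w b k ne by simp
    qed
    \<comment> \<open>In this combination the \<open>A (s - 1)\<close>- and \<open>W 0\<close>-coordinates of the two brackets cancel.\<close>
    define r where "r = cD b' * cZ (g_bracket s b f) - cD b * cZ (g_bracket s b' f)"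
    have r: "r *\<^sub>R eZ s = (cD b' * k) *\<^sub>R w + (- cD b * k') *\<^sub>R w'"
    proof -
      have "r *\<^sub>R eZ s = cD b' *\<^sub>R g_bracket s b f + (- cD b) *\<^sub>R g_bracket s b' f"
        unfolding r_def bracket_top[OF b(1)] bracket_top[OF b(2)] by (intro g_space_eqI[of _ s]) auto
      then show ?thesis by (simp add: w w')
    qed
    have rr: "r * rep (eZ s) e = cD b' * k * rep w e - cD b * k' * rep w' e" for e
      using arg_cong[OF r, of "\<lambda>x. rep x e"] w w'
      by (simp add: rep_add rep_scale B_in del: scaleR_minus_left)
    have "r \<noteq> 0" using rr[of w] w(1) w'(1) b k \<open>w \<noteq> w'\<close> by (auto simp: rep_basis)
    have "rep (eZ s) e \<noteq> 0 \<longleftrightarrow> e = w \<or> e = w'" for e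
    proof -
      have "rep (eZ s) e \<noteq> 0 \<longleftrightarrow> r * rep (eZ s) e \<noteq> 0" using \<open>r \<noteq> 0\<close> by simp
      then show ?thesis unfolding rr using w(1) w'(1) b k \<open>w \<noteq> w'\<close> by (auto simp: rep_basis)
    qed
    then have "{e. rep (eZ s) e \<noteq> 0} = {w, w'}" by blast
    then show ?thesis using k w w' by blast
  qed
  have "eA s (s - 2) \<in> ?G" using s by (intro eA_lower_central) simp
  moreover have "cA (eA s (s - 2)) (s - 2) \<noteq> 0" using s by simp
  ultimately obtain f1 where f1: "f1 \<in> ?G" "f1 \<in> B" "cA f1 (s - 2) \<noteq> 0"
    using adapted_functional[OF adG coord_linear(4)] by blast
  let ?psi = "\<lambda>u. cA f1 (s - 2) * cW u 1 - cW f1 1 * cA u (s - 2)"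
  have "linear ?psi" by (rule linearI) (simp_all add: algebra_simps)
  moreover have "eW s 1 \<in> ?G"
    using eW_lower_central[of "s - 2" s] s by (simp add: numeral_eq_Suc Suc_diff_Suc)
  moreover have "?psi (eW s 1) \<noteq> 0" using f1 s by simp
  ultimately obtain f2 where f2: "f2 \<in> ?G" "f2 \<in> B" "?psi f2 \<noteq> 0"
    using adapted_functional[OF adG] by blast
  obtain w1 v1 k1 l1 where 1: "k1 \<noteq> 0" "l1 \<noteq> 0"
    "g_bracket s b f1 = k1 *\<^sub>R w1" "g_bracket s b' f1 = l1 *\<^sub>R v1"
    "{e. rep (eZ s) e \<noteq> 0} = {w1, v1}" using key[of f1] f1 by blast
  have f2': "cA f2 (s - 2) \<noteq> 0 \<or> cW f2 1 \<noteq> 0" using f2(3) by auto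
  obtain w2 k2 where 2: "k2 \<noteq> 0" "g_bracket s b f2 = k2 *\<^sub>R w2" "w2 \<in> {e. rep (eZ s) e \<noteq> 0}"
    using key[OF f2(1,2) f2'] by auto
  have not_proportional: False
    if c: "c \<in> B" "cD c \<noteq> 0" and l: "l \<noteq> 0" and eq: "g_bracket s c f1 = l *\<^sub>R w2" for c l
  proof -
    have "k2 *\<^sub>R g_bracket s c f1 = l *\<^sub>R g_bracket s b f2" using eq 2 by (simp add: mult.commute)
    then have "cA (k2 *\<^sub>R g_bracket s c f1) (s - 1) = cA (l *\<^sub>R g_bracket s b f2) (s - 1)"
      "cW (k2 *\<^sub>R g_bracket s c f1) 0 = cW (l *\<^sub>R g_bracket s b f2) 0" by simp_all
    moreover have "f1 \<in> filtration s (s - 2)" "f2 \<in> filtration s (s - 2)" using f1 f2 G by auto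
    ultimately have e: "k2 * cD c * cA f1 (s - 2) = l * cD b * cA f2 (s - 2)"
      "k2 * cD c * cW f1 1 = l * cD b * cW f2 1"
      using s b c by (simp_all add: bracket_filtration_top B_in)
    have "l * cD b * ?psi f2 =
        cA f1 (s - 2) * (l * cD b * cW f2 1) - cW f1 1 * (l * cD b * cA f2 (s - 2))"
      by (simp add: algebra_simps)
    also have "\<dots> = 0" unfolding e[symmetric] by simp
    finally show False using l b f2(3) by simp
  qed
  show False using not_proportional[of b k1] not_proportional[of b' l1] 1 2 b by auto
qed

lemma g_space_not_nice:
  assumes s: "s \<ge> 3"
  shows "\<not> nice_lie (g_space s) (g_bracket s)"
proof
  assume "nice_lie (g_space s) (g_bracket s)"
  then obtain B where nice: "nice_basis B (g_space s) (g_bracket s)" unfolding nice_lie_def by blast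
  interpret lie_algebra "g_space s" "g_bracket s" by (rule g_space_lie_algebra[OF s])
  interpret nice_lie_algebra "g_space s" "g_bracket s" B by unfold_locales (rule nice)
  \<comment> \<open>The line through \<open>Z\<close> contains a basis element \<open>e0\<close>.\<close>
  define H where "H = {u \<in> g_space s. cD u = 0}"
  have "adapted H"
    unfolding adapted_def
  proof (intro conjI ballI impI)
    show "subspace H" unfolding H_def by (rule subspaceI) auto
    show "H \<subseteq> g_space s" unfolding H_def by blast
    fix x b assume x: "x \<in> H" and b: "b \<in> B" and nz: "rep x b \<noteq> 0"
    have "cD b = 0"
    proof (rule ccontr)
      assume D: "cD b \<noteq> 0"
      have "cD x = (\<Sum>e\<in>B. rep x e *\<^sub>R cD e)"
        using x rep_linear_functional[OF coord_linear(1)] unfolding H_def by auto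
      also have "\<dots> = (\<Sum>e\<in>B. if e = b then rep x b * cD b else 0)"
        using nice_basis_unique_D[OF s nice b _ D] by (intro sum.cong) auto
      also have "\<dots> = rep x b * cD b" using b finite_B by simp
      finally show False using x nz D unfolding H_def by simp
    qed
    then show "b \<in> H" using b B_in unfolding H_def by blast
  qed
  define G where "G = lower_central (g_space s) (g_bracket s) (s - 2)"
  define P where "P = span {g_bracket s x y | x y. x \<in> H \<and> y \<in> G}"
  have "adapted P" unfolding P_def G_def
    by (intro adapted_bracket \<open>adapted H\<close> adapted_lower_central)
  have G: "G \<subseteq> filtration s (s - 2)" unfolding G_def using lower_central_in_filtration s by simp
  have "g_bracket s x y \<in> span {eZ s}" if "x \<in> H" "y \<in> G" for x y
  proof -
    have "g_bracket s x y = cZ (g_bracket s x y) *\<^sub>R eZ s"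
      using that G s by (intro g_space_eqI[of _ s]) (auto simp: H_def bracket_filtration_top)
    then show ?thesis by (metis span_base span_scale singletonI)
  qed
  then have P: "P \<subseteq> span {eZ s}" unfolding P_def by (intro span_minimal) auto
  have "eA s 0 \<in> H" unfolding H_def by simp
  moreover have "eW s 1 \<in> G"
    unfolding G_def using eW_lower_central[of "s - 2" s] s
    by (simp add: numeral_eq_Suc Suc_diff_Suc)
  ultimately have "eZ s \<in> P" unfolding P_def eZ_eq_bracket[OF s] by (intro span_base) blast
  moreover have "cZ (eZ s) \<noteq> 0" by simp
  ultimately obtain e0 where e0: "e0 \<in> P" "e0 \<in> B" "cZ e0 \<noteq> 0"
    using adapted_functional[OF \<open>adapted P\<close> coord_linear(2)] by blast
  obtain t where t: "e0 = t *\<^sub>R eZ s" using P e0 by (auto simp: span_singleton)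
  then have "t \<noteq> 0" using e0 by auto
  then have eZ: "eZ s = inverse t *\<^sub>R e0" using t by simp

  \<comment> \<open>The bracket on the adapted subspace \<open>X\<close> is given by the pencil of \<open>rho\<close> and \<open>omega\<close>.\<close>
  define X where "X = centralizer (lower_central (g_space s) (g_bracket s) 1)"
  have adX: "adapted X" unfolding X_def by (intro adapted_centralizer adapted_lower_central)
  have XL: "X \<subseteq> g_space s" unfolding X_def centralizer_def by blast
  have bracket_X: "g_bracket s u v = rho u v *\<^sub>R eZ s + omega u v *\<^sub>R eW s 0" if "u \<in> X" "v \<in> X" for u v
  proof -
    have c: "cD u = 0" "cW u (s - 1) = 0" "\<And>i. i + 2 < s \<Longrightarrow> cA u i = 0" if "u \<in> X" for u
      using centralizer_derived[OF s, of u] that unfolding X_def centralizer_def by blast+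
    show ?thesis using that XL c by (intro bracket_centralizer[OF s]) auto
  qed
  have eX: "eX s x \<in> X" for x
    unfolding X_def centralizer_def using eX_centralizes[OF s] by simp
  define E where "E = X \<inter> B"
  have E: "span E = X" unfolding E_def using adapted_span[OF adX] by simp
  have EX: "\<And>u. u \<in> E \<Longrightarrow> u \<in> X" and EB: "\<And>u. u \<in> E \<Longrightarrow> u \<in> B" unfolding E_def by auto

  \<comment> \<open>A basis element \<open>f\<close> outside the line through \<open>Z\<close> arises from a bracket with \<open>omega e' e \<noteq> 0\<close>.\<close>
  let ?x = "eX s (\<lambda>k. if k = 0 then 1 else 0)" and ?y = "eX s (\<lambda>k. if k = 1 then 1 else 0)"
  have "omega ?x ?y \<noteq> 0" by (simp add: omega_expand)
  then obtain e' where e': "e' \<in> X" "e' \<in> B" "omega ?x e' \<noteq> 0"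
    using adapted_functional[OF adX forms_linear eX] by blast
  then have "omega e' ?x \<noteq> 0" using forms_skew(1)[of e' ?x] by simp
  then obtain e where e: "e \<in> X" "e \<in> B" "omega e' e \<noteq> 0"
    using adapted_functional[OF adX forms_linear eX] by blast
  obtain f k where f: "f \<in> B" "g_bracket s e' e = k *\<^sub>R f" using bracket_multiple e e' by blast
  define c where "c = rho e' e / omega e' e"
  have "omega e' e *\<^sub>R eW s 0 = k *\<^sub>R f - rho e' e *\<^sub>R eZ s"
    using bracket_X[OF e'(1) e(1)] f(2) by simp
  then have "inverse (omega e' e) *\<^sub>R (omega e' e *\<^sub>R eW s 0)
      = inverse (omega e' e) *\<^sub>R (k *\<^sub>R f - rho e' e *\<^sub>R eZ s)" by simp
  then have W0: "eW s 0 = (k / omega e' e) *\<^sub>R f - c *\<^sub>R eZ s"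
    using e(3) unfolding c_def by (simp add: scaleR_diff_right divide_inverse mult.commute)
  define m where "m = k / omega e' e"
  have "cW (eW s 0) 0 = 1" "cW (eZ s) 0 = 0" "cW e0 0 = 0" using s t by auto
  then have "m * cW f 0 = 1"
    using W0 unfolding m_def by (metis coord_diff(6) coord_scale(6) diff_zero mult_zero_right)
  then have "m \<noteq> 0" "f \<noteq> e0" using \<open>cW e0 0 = 0\<close> by auto

  have bracket_E: "g_bracket s u v = ((rho u v - c * omega u v) / t) *\<^sub>R e0 + (omega u v * m) *\<^sub>R f"
    if "u \<in> E" "v \<in> E" for u v
  proof -
    have "g_bracket s u v = rho u v *\<^sub>R eZ s + omega u v *\<^sub>R (m *\<^sub>R f - c *\<^sub>R eZ s)"
      using bracket_X[OF EX EX] that W0 unfolding m_def by simp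
    also have "\<dots> = (rho u v - c * omega u v) *\<^sub>R eZ s + (omega u v * m) *\<^sub>R f"
      by (simp add: algebra_simps)
    finally show ?thesis unfolding eZ by (simp add: divide_inverse)
  qed
  have rep_E: "rep (g_bracket s u v) e0 = (rho u v - c * omega u v) / t"
      "rep (g_bracket s u v) f = omega u v * m"
    if "u \<in> E" "v \<in> E" for u v
    unfolding bracket_E[OF that] using e0(2) f(1) \<open>f \<noteq> e0\<close>
    by (simp_all add: rep_add rep_scale B_in rep_basis)

  show False
  proof (rule no_simultaneous_matching[of "xvec ` E" c])
    have "p \<in> xvec ` X" for p using xvec_surj[of s p] eX by (metis image_eqI)
    moreover have "xvec ` X = span (xvec ` E)" using linear_xvec E by (metis linear_span_image)
    ultimately show "span (xvec ` E) = UNIV" by blast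
  next
    fix u v assume "u \<in> xvec ` E" "v \<in> xvec ` E"
    then obtain a b where ab: "u = xvec a" "v = xvec b" "a \<in> E" "b \<in> E" by blast
    show "omega6 u v = 0 \<or> rho6 u v - c * omega6 u v = 0"
      using bracket_component_unique[of a b e0 f] ab EB rep_E[of a b] \<open>f \<noteq> e0\<close> \<open>m \<noteq> 0\<close> \<open>t \<noteq> 0\<close>
      by (auto simp: forms_xvec)
  next
    fix u v w assume "u \<in> xvec ` E" "v \<in> xvec ` E" "w \<in> xvec ` E"
    then obtain a b d where ab: "u = xvec a" "v = xvec b" "w = xvec d" "a \<in> E" "b \<in> E" "d \<in> E"
      by blast
    show "v = w" if "omega6 u v \<noteq> 0" "omega6 u w \<noteq> 0"
      using bracket_partner_unique[of a f b d] that ab EB f(1) rep_E[of a b] rep_E[of a d] \<open>m \<noteq> 0\<close>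
      by (auto simp: forms_xvec)
    show "v = w" if "rho6 u v - c * omega6 u v \<noteq> 0" "rho6 u w - c * omega6 u w \<noteq> 0"
      using bracket_partner_unique[of a e0 b d] that ab EB e0(2) rep_E[of a b] rep_E[of a d] \<open>t \<noteq> 0\<close>
      by (auto simp: forms_xvec)
  qed
qed

theorem theorem3p13:
  fixes s :: nat
  assumes "s \<ge> 3"
  shows "\<exists>(L :: (nat \<Rightarrow>\<^sub>0 real) set) br.
    lie_algebra L br \<and> step_nilpotent s L br \<and> irreducible_lie L br \<and> \<not> nice_lie L br \<and>
    (\<exists>g. ad_invariant_metric L br g)"
  using g_space_lie_algebra[OF assms] g_space_step_nilpotent[OF assms] g_space_irreducible[OF assms]
    g_space_not_nice[OF assms] g_metric_ad_invariant[OF assms] by blast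

end
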